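(* Let $G$ be a profinite group and $U$ an open subgroup of $G$. For every $[V]\in\mathcal O(U)$ and every $[W]\in\mathcal O(G)$, the polynomial $$Q_{V,W}(q)=\sum_{\substack{[S]\in\mathcal O(U)\\ [W]\preceq[S]\text{ in }\mathcal O(G)\\ [S]\preceq[V]\text{ in }\mathcal O(U)}}\mu_U^q([V],[S])\,\varphi_S(G/W)\,q^{(W:S)-1}\ \in\ \mathbb Q[q]$$ is a numerical polynomial in $q$.
   Context: For a profinite group $G$: $\varphi_S(X)=|X^S|$ for a $G$-space $X$ and an open subgroup $S$; $\mathcal O(G)$ is the set of conjugacy classes of open subgroups, ordered by $[V]\preceq[U]$ iff $U$ lies in some $G$-conjugate of $V$; for $[V]\preceq[U]$, $(V:U):=(G:U)/(G:V)$. The same applies to the profinite group $U$. Let $\zeta_U^q$ be the $\mathcal O(U)\times\mathcal O(U)$ matrix over $\mathbb Q[q]$ ($q$ an indeterminate) with entries $\zeta_U^q([V],[S])=\varphi_V(U/S)\,q^{(S:V)-1}$ if $[S]\preceq[V]$ in $\mathcal O(U)$ and $0$ otherwise; $\mu_U^q$ denotes its inverse. A numerical polynomial is an element of $\mathbb Q[q]$ taking integer values at all integers. (These polynomials are the coefficients of the $q$-restriction map: the matrix of $q\text{-}{\rm Res}_U^G$ over a special $\lambda$-ring that is a $\mathbb Q$-algebra has entries $Q_{V,W}(q)\Psi^{(W:V)}$.) *)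

theory Defs
  imports
    "HOL-Algebra.Left_Coset"
    "HOL-Algebra.Group_Action"
    "HOL-Analysis.Analysis"
    "HOL-Computational_Algebra.Polynomial"
begin

locale topological_group = group G for G :: "('a, 'b) monoid_scheme" (structure) +
  fixes T :: "'a topology"
  assumes topspace_eq: "topspace T = carrier G"
    and continuous_mult: "continuous_map (prod_topology T T) T (\<lambda>(x, y). x \<otimes> y)"
    and continuous_inv: "continuous_map T T (\<lambda>x. inv x)"

locale profinite_group = topological_group +
  assumes compact: "compact_space T"
    and Hausdorff: "Hausdorff_space T"
    and totally_disconnected: "\<And>x. x \<in> topspace T \<Longrightarrow> connected_component_of_set T x = {x}"

text \<open>An open subgroup \<open>U\<close> of \<open>(G, T)\<close> is again a profinite group, namely
  \<open>(G\<lparr>carrier := U\<rparr>, subtopology T U)\<close>; all notions below take the ambient group and its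
  topology as arguments, so that they apply to \<open>G\<close> and to \<open>U\<close> alike.\<close>

definition open_subgroup :: "('a, 'b) monoid_scheme \<Rightarrow> 'a topology \<Rightarrow> 'a set \<Rightarrow> bool" where
  "open_subgroup G T H \<longleftrightarrow> subgroup H G \<and> openin T H"

definition conj_class :: "('a, 'b) monoid_scheme \<Rightarrow> 'a set \<Rightarrow> 'a set set" where
  "conj_class G H = {g <#\<^bsub>G\<^esub> H #>\<^bsub>G\<^esub> inv\<^bsub>G\<^esub> g | g. g \<in> carrier G}"

definition open_classes :: "('a, 'b) monoid_scheme \<Rightarrow> 'a topology \<Rightarrow> 'a set set set" where
  "open_classes G T = {conj_class G H | H. open_subgroup G T H}"

text \<open>\<open>conj_le G V U\<close> is the relation \<open>[V] \<preceq> [U]\<close>: the smaller class consists of the larger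
  subgroups.\<close>

definition conj_le :: "('a, 'b) monoid_scheme \<Rightarrow> 'a set \<Rightarrow> 'a set \<Rightarrow> bool" where
  "conj_le G V U \<longleftrightarrow> (\<exists>g \<in> carrier G. U \<subseteq> g <#\<^bsub>G\<^esub> V #>\<^bsub>G\<^esub> inv\<^bsub>G\<^esub> g)"

definition subgroup_index :: "('a, 'b) monoid_scheme \<Rightarrow> 'a set \<Rightarrow> nat" where
  "subgroup_index G H = card (lcosets\<^bsub>G\<^esub> H)"

text \<open>\<open>rel_index G V U\<close> is \<open>(V : U) = (G : U) / (G : V)\<close>. It is only used when \<open>[V] \<preceq> [U]\<close>, and
  then the division is exact.\<close>

definition rel_index :: "('a, 'b) monoid_scheme \<Rightarrow> 'a set \<Rightarrow> 'a set \<Rightarrow> nat" where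
  "rel_index G V U = subgroup_index G U div subgroup_index G V"

definition num_fixed :: "'a set \<Rightarrow> 'x set \<Rightarrow> ('a \<Rightarrow> 'x \<Rightarrow> 'x) \<Rightarrow> nat" where
  "num_fixed S X act = card {x \<in> X. \<forall>s \<in> S. act s x = x}"

text \<open>\<open>phi G S W\<close> is \<open>\<phi>\<^sub>S(G/W)\<close>, with \<open>G\<close> acting on the left cosets of \<open>W\<close> by left translation.\<close>

definition phi :: "('a, 'b) monoid_scheme \<Rightarrow> 'a set \<Rightarrow> 'a set \<Rightarrow> nat" where
  "phi G S W = num_fixed S (lcosets\<^bsub>G\<^esub> W) (\<lambda>g C. g <#\<^bsub>G\<^esub> C)"

text \<open>Matrices are indexed by classes, while their entries are written in terms of subgroups.
  Every expression below depends on a subgroup only through its class, so the choice made by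
  \<open>rep\<close> is immaterial.\<close>

definition rep :: "'a set set \<Rightarrow> 'a set" where
  "rep c = (SOME H. H \<in> c)"

text \<open>The index set \<open>\<O>(U)\<close> is infinite in general. A matrix with finite rows can be multiplied
  on the right by any matrix. The rows of \<open>\<zeta>\<close> are finite, because an open subgroup is contained in
  only finitely many subgroups. Inverses are two-sided, with finite rows, and entries outside
  \<open>I \<times> I\<close> are fixed to be \<open>0\<close>.\<close>

definition row_finite :: "'i set \<Rightarrow> ('i \<Rightarrow> 'i \<Rightarrow> 'r::comm_ring_1) \<Rightarrow> bool" where
  "row_finite I A \<longleftrightarrow> (\<forall>i \<in> I. finite {j \<in> I. A i j \<noteq> 0})"

definition mat_mult ::
  "'i set \<Rightarrow> ('i \<Rightarrow> 'i \<Rightarrow> 'r::comm_ring_1) \<Rightarrow> ('i \<Rightarrow> 'i \<Rightarrow> 'r) \<Rightarrow> 'i \<Rightarrow> 'i \<Rightarrow> 'r" where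
  "mat_mult I A B i j = (\<Sum>k | k \<in> I \<and> A i k \<noteq> 0. A i k * B k j)"

definition is_mat_inverse ::
  "'i set \<Rightarrow> ('i \<Rightarrow> 'i \<Rightarrow> 'r::comm_ring_1) \<Rightarrow> ('i \<Rightarrow> 'i \<Rightarrow> 'r) \<Rightarrow> bool" where
  "is_mat_inverse I A B \<longleftrightarrow>
     row_finite I A \<and> row_finite I B \<and>
     (\<forall>i j. i \<notin> I \<or> j \<notin> I \<longrightarrow> B i j = 0) \<and>
     (\<forall>i \<in> I. \<forall>j \<in> I. mat_mult I A B i j = (if i = j then 1 else 0) \<and>
                      mat_mult I B A i j = (if i = j then 1 else 0))"

definition mat_inverse ::
  "'i set \<Rightarrow> ('i \<Rightarrow> 'i \<Rightarrow> 'r::comm_ring_1) \<Rightarrow> 'i \<Rightarrow> 'i \<Rightarrow> 'r" where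
  "mat_inverse I A = (THE B. is_mat_inverse I A B)"

text \<open>\<open>\<zeta>\<^sup>q\<close> and \<open>\<mu>\<^sup>q\<close> for an arbitrary profinite group \<open>(G, T)\<close>; they are used with \<open>U\<close> in place
  of \<open>G\<close>. The indeterminate \<open>q\<close> is the variable of \<open>rat poly\<close>.\<close>

definition zeta_q :: "('a, 'b) monoid_scheme \<Rightarrow> 'a set set \<Rightarrow> 'a set set \<Rightarrow> rat poly" where
  "zeta_q G v s =
     (if conj_le G (rep s) (rep v)
      then monom (of_nat (phi G (rep v) (rep s))) (rel_index G (rep s) (rep v) - 1)
      else 0)"

definition mu_q ::
  "('a, 'b) monoid_scheme \<Rightarrow> 'a topology \<Rightarrow> 'a set set \<Rightarrow> 'a set set \<Rightarrow> rat poly" where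
  "mu_q G T = mat_inverse (open_classes G T) (zeta_q G)"

definition Q_poly ::
  "('a, 'b) monoid_scheme \<Rightarrow> 'a topology \<Rightarrow> 'a set \<Rightarrow> 'a set set \<Rightarrow> 'a set set \<Rightarrow> rat poly" where
  "Q_poly G T U v w =
     (\<Sum>s | s \<in> open_classes (G\<lparr>carrier := U\<rparr>) (subtopology T U) \<and>
            conj_le G (rep w) (rep s) \<and>
            conj_le (G\<lparr>carrier := U\<rparr>) (rep s) (rep v).
        mu_q (G\<lparr>carrier := U\<rparr>) (subtopology T U) v s *
        monom (of_nat (phi G (rep s) (rep w))) (rel_index G (rep w) (rep s) - 1))"

definition numerical_poly :: "rat poly \<Rightarrow> bool" where
  "numerical_poly p \<longleftrightarrow> (\<forall>n::int. poly p (of_int n) \<in> \<int>)"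

end

theory Submission
  imports Defs "HOL-Algebra.Multiplicative_Group" "HOL-Number_Theory.Cong"
begin

text \<open>For fixed \<open>[W]\<close> the polynomials \<open>Q\<^sub>V = Q\<^sub>V\<^sub>,\<^sub>W\<close> are the solution of
  \<open>\<Sum>\<^sub>[\<^sub>S\<^sub>] \<phi>\<^sub>V(U/S) q^((S:V)-1) Q\<^sub>S = \<phi>\<^sub>V(G/W) q^((W:V)-1)\<close>, one equation for each open subgroup
  \<open>V\<close> of \<open>U\<close>. Specialize \<open>q\<close> to an integer \<open>n\<close>, fix a prime \<open>p\<close>, and show that \<open>Q\<^sub>V(n)\<close> is
  \<open>p\<close>-integral by induction on the index of \<open>V\<close>. The coefficient of \<open>Q\<^sub>V\<close> is the order of
  \<open>K = N\<^sub>U(V)/V\<close>, and \<open>K\<close> acts on \<open>(U/S)^V\<close> and on \<open>(G/W)^V\<close>.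

  If \<open>p\<close> divides \<open>n\<close>, decompose these sets into orbits: a stabilizer \<open>L\<close> has order dividing
  \<open>m = (S:V)\<close>, and the \<open>p\<close>-part of \<open>m\<close> divides \<open>n^(m-1)\<close>. So every term of the equation is
  divisible by the \<open>p\<close>-part of \<open>|K|\<close>.

  If \<open>p\<close> does not divide \<open>n\<close>, multiply the equations by \<open>n\<close> and add those belonging to the
  subgroups \<open>\<langle>V, g\<rangle>\<close> for \<open>gV \<in> K\<close>. By Burnside's lemma for colourings with \<open>n\<close> colours all
  coefficients of the sum are divisible by \<open>|K|\<close>, and that of \<open>Q\<^sub>V\<close> is \<open>n |K|\<close>.\<close>

section \<open>Sums over finite group actions\<close>

text \<open>Elements of \<open>BijGroup X\<close> are extensional, hence the
  \<open>restrict\<close>. The action of \<open>inv g\<close> undoes that of \<open>g\<close>, which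
  makes every map a bijection.\<close>

lemma (in group) group_actionI:
  assumes closed: "\<And>g x. g \<in> carrier G \<Longrightarrow> x \<in> X \<Longrightarrow> act g x \<in> X"
    and one: "\<And>x. x \<in> X \<Longrightarrow> act \<one> x = x"
    and mult: "\<And>g h x. g \<in> carrier G \<Longrightarrow> h \<in> carrier G \<Longrightarrow> x \<in> X \<Longrightarrow>
      act (g \<otimes> h) x = act g (act h x)"
  shows "group_action G X (\<lambda>g. restrict (act g) X)"
proof -
  have inv_act: "act (inv g) (act g x) = x" if "g \<in> carrier G" "x \<in> X" for g x
    using mult[of "inv g" g x] one[of x] that by simp
  have act_inv: "act g (act (inv g) x) = x" if "g \<in> carrier G" "x \<in> X" for g x
    using mult[of g "inv g" x] one[of x] that by simp
  have Bij: "restrict (act g) X \<in> Bij X" if "g \<in> carrier G" for g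
  proof -
    have "bij_betw (act g) X X"
      by (rule bij_betw_byWitness[where f' = "act (inv g)"])
        (use that closed inv_act act_inv in auto)
    then show ?thesis
      by (simp add: Bij_def)
  qed
  interpret B: group "BijGroup X"
    by (rule group_BijGroup)
  have "(\<lambda>g. restrict (act g) X) \<in> hom G (BijGroup X)"
  proof (rule homI)
    show "restrict (act g) X \<in> carrier (BijGroup X)" if "g \<in> carrier G" for g
      using Bij[OF that] by (simp add: BijGroup_def)
    show "restrict (act (g \<otimes> h)) X = restrict (act g) X \<otimes>\<^bsub>BijGroup X\<^esub> restrict (act h) X"
      if "g \<in> carrier G" "h \<in> carrier G" for g h
      using Bij[OF that(1)] Bij[OF that(2)] that closed
      by (auto simp: BijGroup_def compose_def mult fun_eq_iff)
  qed
  then show ?thesis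
    by (intro group_action.intro group_hom.intro group_hom_axioms.intro) auto
qed

text \<open>On an orbit \<open>O\<close> the summand is constant and \<open>|O|\<close> times the order of a stabilizer is the
  order of the group.\<close>

lemma (in group) order_dvd_sum_over_action:
  fixes F :: "'x \<Rightarrow> int"
  assumes fin: "finite X"
    and closed: "\<And>g x. g \<in> carrier G \<Longrightarrow> x \<in> X \<Longrightarrow> act g x \<in> X"
    and one: "\<And>x. x \<in> X \<Longrightarrow> act \<one> x = x"
    and mult: "\<And>g h x. g \<in> carrier G \<Longrightarrow> h \<in> carrier G \<Longrightarrow> x \<in> X \<Longrightarrow>
      act (g \<otimes> h) x = act g (act h x)"
    and invariant: "\<And>g x. g \<in> carrier G \<Longrightarrow> x \<in> X \<Longrightarrow> F (act g x) = F x"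
    and stab: "\<And>x. x \<in> X \<Longrightarrow> int (card {g \<in> carrier G. act g x = x}) dvd F x"
  shows "int (Coset.order G) dvd sum F X"
proof -
  let ?a = "\<lambda>g. restrict (act g) X"
  interpret A: group_action G X ?a
    using closed one mult by (rule group_actionI)
  have "int (Coset.order G) dvd sum F Y" if Y: "Y \<in> orbits G X ?a" for Y
  proof -
    obtain x where x: "x \<in> X" "Y = orbit G ?a x"
      using Y by (auto simp: orbits_def)
    have "F y = F x" if "y \<in> Y" for y
      using that x invariant by (auto simp: orbit_def)
    then have "sum F Y = int (card Y) * F x"
      by simp
    moreover have "stabilizer G ?a x = {g \<in> carrier G. act g x = x}"
      using x by (auto simp: stabilizer_def)
    then have "int (Coset.order G) = int (card Y) * int (card {g \<in> carrier G. act g x = x})"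
      using A.orbit_stabilizer_theorem[OF x(1)] x(2) by (metis of_nat_mult)
    ultimately show ?thesis
      using stab[OF x(1)] by (simp add: mult_dvd_mono)
  qed
  then have "int (Coset.order G) dvd (\<Sum>Y\<in>orbits G X ?a. sum F Y)"
    by (rule dvd_sum)
  then show ?thesis
    using A.disjoint_sum[OF fin, of F] by simp
qed

text \<open>Invariance under \<open>g\<close> extends to the cyclic group \<open>C\<close> generated
  by \<open>g\<close>. Such an \<open>f\<close> is therefore constant on the right cosets of
  \<open>C\<close>, and it amounts to a function on \<open>rcosets C\<close>.\<close>

lemma (in group) card_functions_fixed_by_translation:
  assumes fin: "finite (carrier G)" and g: "g \<in> carrier G" and A: "finite A"
  shows "card {f \<in> carrier G \<rightarrow>\<^sub>E A. \<forall>x \<in> carrier G. f (g \<otimes> x) = f x}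
    = card A ^ (Coset.order G div ord g)"
proof -
  define C where "C = generate G {g}"
  have C: "subgroup C G"
    unfolding C_def using g by (intro generate_is_subgroup) auto
  then interpret C: subgroup C G .
  have gC: "g \<in> C"
    by (simp add: C_def generate.incl)
  have card_C: "card C = ord g"
    by (simp add: C_def generate_pow_card[OF g])
  have card_rcosets: "card (rcosets C) = Coset.order G div ord g"
    using lagrange[OF C] ord_ge_1[OF fin g] card_C
    by (metis div_mult_self_is_m less_eq_Suc_le One_nat_def)
  let ?Fix = "{f \<in> carrier G \<rightarrow>\<^sub>E A. \<forall>x \<in> carrier G. f (g \<otimes> x) = f x}"
  have const: "f (c \<otimes> x) = f x" if f: "f \<in> ?Fix" and c: "c \<in> C" and x: "x \<in> carrier G" for f c x
    using c x unfolding C_def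
  proof (induction arbitrary: x rule: generate.induct)
    case (incl h)
    then show ?case using f by auto
  next
    case (inv h)
    then show ?case
    proof -
      have "f (g \<otimes> (inv g \<otimes> x)) = f (inv g \<otimes> x)"
        using f g inv by simp
      then show ?thesis
        using g inv by (simp flip: m_assoc)
    qed
  next
    case (eng h1 h2)
    have "h1 \<in> carrier G" "h2 \<in> carrier G"
      using eng(1,2) C_def C.subset by auto
    then show ?case
      using eng by (simp add: m_assoc)
  qed auto
  have coset_eq: "C #> (c \<otimes> x) = C #> x" if "c \<in> C" "x \<in> carrier G" for c x
    using that coset_mult_assoc[OF C.subset, of c x] C.rcos_const[OF is_group that(1)] by simp
  \<comment> \<open>The inverse map evaluates \<open>f\<close> at a chosen element of each coset; by
    \<open>const\<close> the choice does not matter.\<close>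
  have "bij_betw (\<lambda>h. restrict (\<lambda>x. h (C #> x)) (carrier G)) (rcosets C \<rightarrow>\<^sub>E A) ?Fix"
  proof (rule bij_betw_byWitness[where f' = "\<lambda>f. restrict (\<lambda>D. f (SOME x. x \<in> D)) (rcosets C)"])
    have some: "\<exists>c \<in> C. (SOME y. y \<in> C #> x) = c \<otimes> x" if "x \<in> carrier G" for x
    proof -
      have "(SOME y. y \<in> C #> x) \<in> C #> x"
        using rcos_self[OF that C] by (metis someI_ex)
      then show ?thesis
        by (auto simp: r_coset_def)
    qed
    show "\<forall>h \<in> rcosets C \<rightarrow>\<^sub>E A. restrict (\<lambda>D. restrict (\<lambda>x. h (C #> x)) (carrier G)
        (SOME x. x \<in> D)) (rcosets C) = h"
    proof
      fix h assume h: "h \<in> rcosets C \<rightarrow>\<^sub>E A"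
      have "restrict (\<lambda>x. h (C #> x)) (carrier G) (SOME x. x \<in> D) = h D" if "D \<in> rcosets C" for D
      proof -
        obtain x where x: "x \<in> carrier G" "D = C #> x"
          using \<open>D \<in> rcosets C\<close> by (auto simp: RCOSETS_def)
        then obtain c where "c \<in> C" "(SOME y. y \<in> D) = c \<otimes> x"
          using some by blast
        then show ?thesis
          using x coset_eq C.subset by (auto simp: subset_iff)
      qed
      then show "restrict (\<lambda>D. restrict (\<lambda>x. h (C #> x)) (carrier G) (SOME x. x \<in> D)) (rcosets C) = h"
        using h by (intro ext) (auto simp: PiE_def extensional_def restrict_def)
    qed
    show "\<forall>f \<in> ?Fix. restrict (\<lambda>x. restrict (\<lambda>D. f (SOME x. x \<in> D)) (rcosets C) (C #> x))
        (carrier G) = f"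
    proof
      fix f assume f: "f \<in> ?Fix"
      have "f (SOME y. y \<in> C #> x) = f x" if "x \<in> carrier G" for x
        using some[OF that] const[OF f _ that] by auto
      moreover have "C #> x \<in> rcosets C" if "x \<in> carrier G" for x
        using that by (auto simp: RCOSETS_def)
      ultimately show "restrict (\<lambda>x. restrict (\<lambda>D. f (SOME x. x \<in> D)) (rcosets C) (C #> x))
        (carrier G) = f"
        using f by (intro ext) (auto simp: PiE_def extensional_def restrict_def)
    qed
    show "(\<lambda>h. restrict (\<lambda>x. h (C #> x)) (carrier G)) ` (rcosets C \<rightarrow>\<^sub>E A) \<subseteq> ?Fix"
      using coset_eq[OF gC] g by (auto simp: RCOSETS_def)
    show "(\<lambda>f. restrict (\<lambda>D. f (SOME x. x \<in> D)) (rcosets C)) ` ?Fix \<subseteq> rcosets C \<rightarrow>\<^sub>E A"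
    proof (clarsimp simp: RCOSETS_def)
      fix f x assume f: "f \<in> carrier G \<rightarrow>\<^sub>E A" and x: "x \<in> carrier G"
      obtain c where "c \<in> C" "(SOME y. y \<in> C #> x) = c \<otimes> x"
        using some[OF x] by blast
      then show "f (SOME y. y \<in> C #> x) \<in> A"
        using f x C.subset by (auto simp: subset_iff)
    qed
  qed
  then have "card ?Fix = card (rcosets C \<rightarrow>\<^sub>E A)"
    by (rule bij_betw_same_card[symmetric])
  moreover have "finite (rcosets C)"
    using fin by (auto simp: RCOSETS_def)
  ultimately show ?thesis
    by (simp add: card_PiE card_rcosets)
qed

text \<open>For \<open>a \<ge> 0\<close> the quotient is the number of orbits of \<open>G\<close> on the colourings of \<open>G\<close> with
  \<open>a\<close> colours.\<close>

lemma (in group) order_dvd_sum_power_ord: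
  fixes a :: int
  assumes fin: "finite (carrier G)"
  shows "int (Coset.order G) dvd (\<Sum>g\<in>carrier G. a ^ (Coset.order G div ord g))"
proof -
  \<comment> \<open>The number of colours must be natural, so \<open>a\<close> is replaced by its
    residue modulo the group order. This does not affect the divisibility.\<close>
  define m where "m = nat (a mod int (Coset.order G))"
  have "Coset.order G > 0"
    using fin order_gt_0_iff_finite by simp
  then have m: "[int m = a] (mod int (Coset.order G))"
    by (simp add: m_def cong_def)
  define X where "X = carrier G \<rightarrow>\<^sub>E {..<m}"
  define act where "act = (\<lambda>g f. restrict (\<lambda>x. f (inv g \<otimes> x :: 'a)) (carrier G) :: 'a \<Rightarrow> nat)"
  have finX: "finite X"
    unfolding X_def using fin by (intro finite_PiE) auto
  have closed: "act g f \<in> X" if "g \<in> carrier G" "f \<in> X" for g f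
    using that by (auto simp: X_def act_def)
  have one: "act \<one> f = f" if "f \<in> X" for f
    using that by (auto simp: X_def act_def fun_eq_iff PiE_def extensional_def)
  have mult: "act (g \<otimes> h) f = act g (act h f)" if "g \<in> carrier G" "h \<in> carrier G" "f \<in> X" for g h f
    using that by (auto simp: act_def fun_eq_iff inv_mult_group m_assoc)
  interpret A: group_action G X "\<lambda>g. restrict (act g) X"
    using closed one mult by (rule group_actionI)
  have "card (invariants X (\<lambda>g. restrict (act g) X) g) = m ^ (Coset.order G div ord g)"
    if g: "g \<in> carrier G" for g
  proof -
    \<comment> \<open>Being fixed by \<open>g\<close> is invariance under translation by
      \<open>inv g\<close>, an element of the same order as \<open>g\<close>.\<close>
    have "act g f = f \<longleftrightarrow> (\<forall>x\<in>carrier G. f (inv g \<otimes> x) = f x)" if "f \<in> X" for f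
      using that by (auto simp: X_def act_def fun_eq_iff PiE_def extensional_def)
    then have "invariants X (\<lambda>g. restrict (act g) X) g
      = {f \<in> carrier G \<rightarrow>\<^sub>E {..<m}. \<forall>x\<in>carrier G. f (inv g \<otimes> x) = f x}"
      by (auto simp: invariants_def X_def)
    then show ?thesis
      using card_functions_fixed_by_translation[OF fin, of "inv g" "{..<m}"] g by simp
  qed
  then have "Coset.order G dvd (\<Sum>g\<in>carrier G. m ^ (Coset.order G div ord g))"
  proof -
    have "card (orbits G X (\<lambda>g. restrict (act g) X)) * Coset.order G
        = (\<Sum>g\<in>carrier G. m ^ (Coset.order G div ord g))"
      unfolding A.burnside[OF fin finX] by (rule sum.cong[OF refl]) fact
    then show ?thesis
      by (metis dvd_triv_right)
  qed
  then have "int (Coset.order G) dvd int (\<Sum>g\<in>carrier G. m ^ (Coset.order G div ord g))"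
    by (simp only: int_dvd_int_iff)
  then have "int (Coset.order G) dvd (\<Sum>g\<in>carrier G. int m ^ (Coset.order G div ord g))"
    by simp
  moreover have "[(\<Sum>g\<in>carrier G. int m ^ (Coset.order G div ord g))
      = (\<Sum>g\<in>carrier G. a ^ (Coset.order G div ord g))] (mod int (Coset.order G))"
    by (intro cong_sum cong_pow m)
  ultimately show ?thesis
    by (simp add: cong_dvd_iff)
qed

section \<open>Indices and conjugates\<close>

lemma lcosetsI: "x \<in> carrier G \<Longrightarrow> x <#\<^bsub>G\<^esub> H \<in> lcosets\<^bsub>G\<^esub> H"
  by (auto simp: LCOSETS_def)

text \<open>With a representative \<open>r C\<close> chosen in each coset \<open>C\<close> of
  \<open>B\<close>, every coset of \<open>A\<close> is uniquely \<open>r C <# (b <# A)\<close> with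
  \<open>b <# A\<close> a coset inside \<open>B\<close>. Infinite indices count as 0, and the
  bijection covers them too.\<close>

lemma (in group) subgroup_index_mult:
  assumes A: "subgroup A G" and B: "subgroup B G" and AB: "A \<subseteq> B"
  shows "subgroup_index G A = subgroup_index G B * subgroup_index (G\<lparr>carrier := B\<rparr>) A"
proof -
  interpret A: subgroup A G by fact
  interpret B: subgroup B G by fact
  define r where "r = (\<lambda>C :: 'a set. SOME x. x \<in> C)"
  have r: "r C \<in> C" "r C \<in> carrier G" "r C <# B = C" if "C \<in> lcosets B" for C
  proof -
    obtain x where x: "x \<in> carrier G" "C = x <# B"
      using \<open>C \<in> lcosets B\<close> by (auto simp: LCOSETS_def)
    then show *: "r C \<in> C"
      unfolding r_def using lcos_self[OF x(1) B] by (metis someI_ex)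
    then show "r C \<in> carrier G"
      using x B.elemlcos_carrier is_group by blast
    show "r C <# B = C"
      using x * l_repr_independence B by metis
  qed
  have part: "lcosets\<^bsub>G\<lparr>carrier := B\<rparr>\<^esub> A = (\<lambda>b. b <# A) ` B"
    by (auto simp: LCOSETS_def)
  have "bij_betw (\<lambda>(C, D). r C <# D) ((lcosets B) \<times> (\<lambda>b. b <# A) ` B) (lcosets A)"
    unfolding bij_betw_def
  proof (intro conjI subset_antisym inj_onI subsetI)
    fix P P'
    assume P: "P \<in> (lcosets B) \<times> (\<lambda>b. b <# A) ` B" and P': "P' \<in> (lcosets B) \<times> (\<lambda>b. b <# A) ` B"
      and eq': "(\<lambda>(C, D). r C <# D) P = (\<lambda>(C, D). r C <# D) P'"
    obtain C b C' b' where PP: "P = (C, b <# A)" "P' = (C', b' <# A)"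
      and C: "C \<in> lcosets B" and C': "C' \<in> lcosets B" and b: "b \<in> B" and b': "b' \<in> B"
      using P P' by auto
    have eq: "r C <# (b <# A) = r C' <# (b' <# A)"
      using eq' by (simp add: PP)
    have sub: "r C <# (b <# A) \<subseteq> C" if "C \<in> lcosets B" "b \<in> B" for C b
    proof -
      have "b <# A \<subseteq> B"
        using that(2) AB by (auto simp: l_coset_def)
      then have "r C <# (b <# A) \<subseteq> r C <# B"
        by (auto simp: l_coset_def)
      then show ?thesis
        using r(3)[OF that(1)] by simp
    qed
    have "r C <# (b <# A) \<noteq> {}"
    proof -
      have "A \<noteq> {}"
        using A.one_closed by blast
      then show ?thesis
        by (simp add: l_coset_def)
    qed
    then have "C \<inter> C' \<noteq> {}"
      using sub[OF C b] sub[OF C' b'] eq by blast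
    then have CC: "C = C'"
      using lcos_disjoint[OF B C C'] by blast
    have "inv (r C) <# (r C <# (b <# A)) = b <# A" if "b \<in> B" for b
      using that r(2)[OF C] by (simp add: lcos_m_assoc A.subset flip: m_assoc)
    then show "P = P'"
      using eq CC b b' PP by metis
  next
    fix E
    assume "E \<in> (\<lambda>(C, D). r C <# D) ` ((lcosets B) \<times> (\<lambda>b. b <# A) ` B)"
    then obtain C b where E: "E = r C <# (b <# A)" and "C \<in> lcosets B" "b \<in> B"
      by auto
    then have "r C <# (b <# A) = (r C \<otimes> b) <# A" "r C \<otimes> b \<in> carrier G"
      using r by (auto simp: lcos_m_assoc A.subset)
    then show "E \<in> lcosets A"
      by (auto simp: LCOSETS_def E)
  next
    fix D assume "D \<in> lcosets A"
    then obtain x where x: "x \<in> carrier G" "D = x <# A"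
      by (auto simp: LCOSETS_def)
    let ?C = "x <# B"
    have C: "?C \<in> lcosets B"
      using x by (auto simp: LCOSETS_def)
    have "x \<in> r ?C <# B"
      using r(3)[OF C] lcos_self[OF x(1) B] by simp
    then have b: "inv (r ?C) \<otimes> x \<in> B"
      using B.lcos_module_imp[OF is_group r(2)[OF C]] by simp
    have "r ?C <# ((inv (r ?C) \<otimes> x) <# A) = D"
      using x r(2)[OF C] by (simp add: lcos_m_assoc A.subset flip: m_assoc)
    then show "D \<in> (\<lambda>(C, D). r C <# D) ` ((lcosets B) \<times> (\<lambda>b. b <# A) ` B)"
      using b C by (auto intro!: image_eqI[of _ _ "(x <# B, (inv (r (x <# B)) \<otimes> x) <# A)"])
  qed
  then show ?thesis
    unfolding subgroup_index_def part
    by (simp add: bij_betw_same_card[symmetric] card_cartesian_product)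
qed

lemma (in group) conjugate_eq_image:
  "g <# H #> inv g = (\<lambda>h. g \<otimes> h \<otimes> inv g) ` H"
  by (auto simp: l_coset_def r_coset_def)

lemma (in group) conjugate_conjugate:
  assumes "g \<in> carrier G" "h \<in> carrier G" "H \<subseteq> carrier G"
  shows "g <# (h <# H #> inv h) #> inv g = (g \<otimes> h) <# H #> inv (g \<otimes> h)"
  unfolding conjugate_eq_image image_image
  using assms by (intro image_cong) (auto simp: m_assoc inv_mult_group subset_iff)

lemma (in group) conjugate_one: "H \<subseteq> carrier G \<Longrightarrow> \<one> <# H #> inv \<one> = H"
  unfolding conjugate_eq_image by (auto simp: subset_iff image_iff)

text \<open>Right multiplication by \<open>inv g\<close> carries \<open>x <# H\<close> to the coset
  of the conjugate through \<open>x \<otimes> inv g\<close>.\<close>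

lemma (in group) subgroup_index_conjugate:
  assumes g: "g \<in> carrier G" and H: "subgroup H G"
  shows "subgroup_index G (g <# H #> inv g) = subgroup_index G H"
proof -
  interpret H: subgroup H G by fact
  have eq: "(x \<otimes> inv g) <# (g <# H #> inv g) = (x <# H) #> inv g" if "x \<in> carrier G" for x
  proof -
    have "(x \<otimes> inv g) \<otimes> (g \<otimes> h \<otimes> inv g) = x \<otimes> h \<otimes> inv g" if h: "h \<in> H" for h
    proof -
      have "inv g \<otimes> (g \<otimes> (h \<otimes> inv g)) = h \<otimes> inv g"
        using g h by (simp flip: m_assoc)
      then show ?thesis
        using g h \<open>x \<in> carrier G\<close> by (simp add: m_assoc)
    qed
    then show ?thesis
      by (auto simp: l_coset_def r_coset_def)
  qed
  have inv: "((x <# H) #> inv g) #> g = x <# H" if "x \<in> carrier G" for x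
    using that g by (simp add: coset_mult_assoc l_coset_subset_G H.subset)
  have "bij_betw (\<lambda>C. C #> inv g) (lcosets H) (lcosets (g <# H #> inv g))"
  proof (rule bij_betw_byWitness[where f' = "\<lambda>C. C #> g"])
    show "(\<lambda>C. C #> inv g) ` (lcosets H) \<subseteq> lcosets (g <# H #> inv g)"
    proof (rule image_subsetI)
      fix C assume "C \<in> lcosets H"
      then obtain x where x: "x \<in> carrier G" "C = x <# H"
        by (auto simp: LCOSETS_def)
      have "(x \<otimes> inv g) <# (g <# H #> inv g) \<in> lcosets (g <# H #> inv g)"
        using x g by (intro lcosetsI) simp
      then show "C #> inv g \<in> lcosets (g <# H #> inv g)"
        by (simp only: eq[OF x(1)] x(2))
    qed
    have "(x <# (g <# H #> inv g)) = ((x \<otimes> g) <# H) #> inv g" if "x \<in> carrier G" for x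
      using eq[of "x \<otimes> g"] that g by (simp add: m_assoc)
    then show "\<forall>C \<in> lcosets (g <# H #> inv g). C #> g #> inv g = C"
      "(\<lambda>C. C #> g) ` (lcosets (g <# H #> inv g)) \<subseteq> lcosets H"
      using g by (auto simp: LCOSETS_def inv)
  qed (auto simp: LCOSETS_def inv)
  then show ?thesis
    unfolding subgroup_index_def by (rule bij_betw_same_card[symmetric])
qed

text \<open>The element \<open>g\<close> fixes \<open>x <# W\<close> exactly if
  \<open>inv x \<otimes> g \<otimes> x\<close> lies in \<open>W\<close>.\<close>

lemma (in group) coset_stabilizer_eq_conjugate:
  assumes x: "x \<in> carrier G" and W: "subgroup W G"
  shows "{g \<in> carrier G. g <# (x <# W) = x <# W} = x <# W #> inv x"
proof -
  interpret W: subgroup W G by fact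
  have "g <# (x <# W) = x <# W \<longleftrightarrow> inv x \<otimes> g \<otimes> x \<in> W" if g: "g \<in> carrier G" for g
  proof
    assume "g <# (x <# W) = x <# W"
    then have "(g \<otimes> x) <# W = x <# W"
      using g x by (simp add: lcos_m_assoc W.subset)
    then have "g \<otimes> x \<in> x <# W"
      using lcos_self[of "g \<otimes> x" W] g x W by simp
    then show "inv x \<otimes> g \<otimes> x \<in> W"
      using W.lcos_module_imp[OF is_group x] g x by (simp add: m_assoc)
  next
    assume "inv x \<otimes> g \<otimes> x \<in> W"
    then have "g \<otimes> x \<in> x <# W"
      using W.lcos_module_rev[OF is_group x, of "g \<otimes> x"] g x by (simp add: m_assoc)
    then have "x <# W = (g \<otimes> x) <# W"
      using l_repr_independence x W by metis
    then show "g <# (x <# W) = x <# W"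
      using lcos_m_assoc[OF W.subset g x] by simp
  qed
  moreover have "inv x \<otimes> g \<otimes> x \<in> W \<longleftrightarrow> g \<in> x <# W #> inv x" if g: "g \<in> carrier G" for g
  proof
    assume "inv x \<otimes> g \<otimes> x \<in> W"
    moreover have "g = x \<otimes> (inv x \<otimes> g \<otimes> x) \<otimes> inv x"
      using x g by (simp add: m_assoc) (simp flip: m_assoc)
    ultimately show "g \<in> x <# W #> inv x"
      unfolding conjugate_eq_image by blast
  next
    assume "g \<in> x <# W #> inv x"
    then obtain w where "w \<in> W" "g = x \<otimes> w \<otimes> inv x"
      unfolding conjugate_eq_image by blast
    then have "inv x \<otimes> g \<otimes> x = w"
      using x by (simp add: m_assoc) (simp flip: m_assoc)
    with \<open>w \<in> W\<close> show "inv x \<otimes> g \<otimes> x \<in> W" by simp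
  qed
  moreover have "x <# W #> inv x \<subseteq> carrier G"
    using x W.subset by (auto simp: conjugate_eq_image)
  ultimately show ?thesis by blast
qed

text \<open>Left translation by \<open>g\<close> carries the cosets fixed by \<open>S\<close> to
  those fixed by the conjugate of \<open>S\<close>. Together with the invariance of indices, this
  frees the equations from the choice of \<open>rep\<close>.\<close>

lemma (in group) phi_conjugate:
  assumes g: "g \<in> carrier G" and S: "S \<subseteq> carrier G" and W: "subgroup W G"
  shows "phi G (g <# S #> inv g) W = phi G S W"
proof -
  have carrier: "D \<subseteq> carrier G" if "D \<in> lcosets W" for D
    using that subgroup.lcosets_carrier[OF W is_group] by simp
  have closed: "a <# D \<in> lcosets W" if "a \<in> carrier G" "D \<in> lcosets W" for a D
    using that W by (auto simp: LCOSETS_def lcos_m_assoc subgroup.subset)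
  have cancel: "inv a <# (a <# D) = D" "a <# (inv a <# D) = D"
    if "a \<in> carrier G" "D \<in> lcosets W" for a D
    using that carrier by (simp_all add: lcos_m_assoc lcos_mult_one)
  let ?F = "\<lambda>S. {D \<in> lcosets W. \<forall>s\<in>S. s <# D = D}"
  have fixed: "(\<forall>s \<in> g <# S #> inv g. s <# (g <# D) = g <# D) \<longleftrightarrow> (\<forall>s\<in>S. s <# D = D)"
    if D: "D \<in> lcosets W" for D
  proof -
    have "(g \<otimes> s \<otimes> inv g) <# (g <# D) = g <# (s <# D)" if "s \<in> S" for s
      using that S g carrier[OF D] by (simp add: lcos_m_assoc subset_iff m_assoc)
    moreover have "g <# (s <# D) = g <# D \<longleftrightarrow> s <# D = D" if "s \<in> S" for s
      using cancel(1)[OF g D] cancel(1)[OF g closed[OF _ D, of s]] S that by (metis subsetD)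
    ultimately show ?thesis
      unfolding conjugate_eq_image by simp
  qed
  have "bij_betw (\<lambda>D. g <# D) (?F S) (?F (g <# S #> inv g))"
  proof (rule bij_betw_byWitness[where f' = "\<lambda>D. inv g <# D"])
    show "(\<lambda>D. inv g <# D) ` ?F (g <# S #> inv g) \<subseteq> ?F S"
    proof (rule image_subsetI)
      fix E assume E: "E \<in> ?F (g <# S #> inv g)"
      then have D: "inv g <# E \<in> lcosets W" and eq: "g <# (inv g <# E) = E"
        using cancel(2)[OF g, of E] closed[of "inv g" E] g by auto
      then show "inv g <# E \<in> ?F S"
        using E fixed[OF D] unfolding eq by blast
    qed
    show "(\<lambda>D. g <# D) ` ?F S \<subseteq> ?F (g <# S #> inv g)"
      using closed[OF g] fixed by auto
  qed (use cancel g in auto)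
  then show ?thesis
    unfolding phi_def num_fixed_def by (rule bij_betw_same_card[symmetric])
qed

section \<open>Sections acting on fixed cosets\<close>

lemma (in group) card_subgroup_dvd:
  assumes H: "subgroup H G" and J: "subgroup J G" and "J \<subseteq> H"
  shows "card J dvd card H"
proof -
  interpret H: group "G\<lparr>carrier := H\<rparr>"
    using H subgroup.subgroup_is_group is_group by blast
  have "card (rcosets\<^bsub>G\<lparr>carrier := H\<rparr>\<^esub> J) * card J = card H"
    using H.lagrange[of J] subgroup_incl[OF J H] assms(3) by (simp add: Coset.order_def)
  then show ?thesis
    by (metis dvd_triv_right)
qed

lemma (in group) ord_conjugate:
  assumes g: "g \<in> carrier G" and x: "x \<in> carrier G"
  shows "ord (g \<otimes> x \<otimes> inv g) = ord x"
proof -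
  have pow: "(g \<otimes> x \<otimes> inv g) [^] n = g \<otimes> x [^] n \<otimes> inv g" for n :: nat
  proof (induction n)
    case (Suc n)
    have "(g \<otimes> x \<otimes> inv g) [^] Suc n = (g \<otimes> x [^] n \<otimes> inv g) \<otimes> (g \<otimes> x \<otimes> inv g)"
      using Suc by simp
    also have "\<dots> = g \<otimes> x [^] n \<otimes> (inv g \<otimes> g) \<otimes> x \<otimes> inv g"
      using g x by (simp only: m_assoc m_closed inv_closed nat_pow_closed)
    also have "\<dots> = g \<otimes> x [^] Suc n \<otimes> inv g"
      using g x by (simp add: m_assoc)
    finally show ?case .
  qed (use g in simp)
  have "g \<otimes> y \<otimes> inv g = \<one> \<longleftrightarrow> y = \<one>" if "y \<in> carrier G" for y
    using g that by (simp add: inv_solve_right')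
  then have "(g \<otimes> x \<otimes> inv g) [^] n = \<one> \<longleftrightarrow> x [^] n = \<one>" for n :: nat
    using x by (simp add: pow)
  then show ?thesis
    by (simp add: ord_def)
qed

text \<open>Elements have the same order in \<open>H\<close> as in \<open>G\<close>, so the
  statement for whole groups applies. It will be used for stabilizers.\<close>

lemma (in group) order_dvd_sum_power_ord_subgroup:
  fixes a :: int
  assumes fin: "finite (carrier G)" and H: "subgroup H G"
  shows "int (card H) dvd (\<Sum>g\<in>H. a ^ (card H div ord g))"
proof -
  interpret H: group "G\<lparr>carrier := H\<rparr>"
    using H subgroup.subgroup_is_group is_group by blast
  have "H.ord g = ord g" for g
    unfolding H.ord_def ord_def by (simp flip: nat_pow_consistent)
  moreover have "finite H"
    using fin subgroup.subset[OF H] finite_subset by blast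
  ultimately show ?thesis
    using H.order_dvd_sum_power_ord[of a] by (simp add: Coset.order_def)
qed

text \<open>The group \<open>H/V\<close> acts on the cosets in \<open>G/W\<close> fixed by \<open>V\<close>.\<close>

locale section_acting = group G for G (structure) +
  fixes H V W :: "'a set"
  assumes H: "subgroup H G"
    and V: "V \<lhd> (G\<lparr>carrier := H\<rparr>)"
    and W: "subgroup W G"
    and index_V: "subgroup_index G V > 0"
    and index_W: "subgroup_index G W > 0"
begin

abbreviation K :: "'a set monoid" where
  "K \<equiv> (G\<lparr>carrier := H\<rparr>) Mod V"

definition X :: "'a set set" where
  "X = {D \<in> lcosets W. \<forall>v\<in>V. v <# D = D}"

sublocale N: normal V "G\<lparr>carrier := H\<rparr>"
  by (fact V)

sublocale K: group K
  by (rule N.factorgroup_is_group)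

lemma V_le_H: "V \<subseteq> H"
  using N.subset by simp

lemma subgroup_V: "subgroup V G"
  using incl_subgroup[OF H N.subgroup_axioms] .

lemma H_carrier: "h \<in> H \<Longrightarrow> h \<in> carrier G"
  using subgroup.subset[OF H] by blast

lemma V_carrier: "v \<in> V \<Longrightarrow> v \<in> carrier G"
  using V_le_H H_carrier by blast

text \<open>The quotient \<open>K\<close> is built from right cosets, while indices and
  \<open>phi\<close> count left cosets; by normality of \<open>V\<close> in \<open>H\<close> the two
  agree here.\<close>

lemma coset_commute: "h \<in> H \<Longrightarrow> V #> h = h <# V"
  using N.coset_eq by simp

lemma carrier_K: "carrier K = (\<lambda>h. h <# V) ` H"
  by (auto simp: carrier_FactGroup coset_commute)

lemma finite_K: "finite (carrier K)"
proof -
  have "carrier K \<subseteq> lcosets V"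
    by (auto simp: carrier_K intro: lcosetsI H_carrier)
  moreover have "finite (lcosets V)"
    using index_V by (auto simp: subgroup_index_def intro: card_ge_0_finite)
  ultimately show ?thesis
    by (rule finite_subset)
qed

lemma finite_X: "finite X"
proof -
  have "finite (lcosets W)"
    using index_W by (auto simp: subgroup_index_def intro: card_ge_0_finite)
  then show ?thesis
    by (simp add: X_def)
qed

lemma X_subset: "D \<in> X \<Longrightarrow> D \<subseteq> carrier G"
  using subgroup.lcosets_carrier[OF W is_group] by (simp add: X_def)

text \<open>An element of \<open>K\<close> is a subset of \<open>G\<close> and acts by the set
  product, so no representative has to be chosen. Since \<open>V\<close> fixes \<open>D\<close>, the
  product \<open>V <#> D\<close> is \<open>D\<close> itself.\<close>

lemma coset_act: "h \<in> H \<Longrightarrow> D \<in> X \<Longrightarrow> (h <# V) <#> D = h <# D"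
proof -
  assume h: "h \<in> H" and D: "D \<in> X"
  have VD: "V <#> D = D"
  proof -
    have "V <#> D = (\<Union>v\<in>V. v <# D)"
      by (auto simp: set_mult_def l_coset_def)
    also have "\<dots> = D"
      using D subgroup.one_closed[OF subgroup_V] by (auto simp: X_def)
    finally show ?thesis .
  qed
  have "V \<subseteq> carrier G"
    using V_carrier by blast
  then show ?thesis
    using h X_subset[OF D] VD l_coset_eq_set_mult[of G h V] l_coset_eq_set_mult[of G h D]
      set_mult_assoc[of "{h}" V D] H_carrier by simp
qed

lemma act_closed: "\<kappa> \<in> carrier K \<Longrightarrow> D \<in> X \<Longrightarrow> \<kappa> <#> D \<in> X"
proof -
  assume "\<kappa> \<in> carrier K" and D: "D \<in> X"
  then obtain h where h: "h \<in> H" "\<kappa> = h <# V"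
    by (auto simp: carrier_K)
  have "h <# D \<in> lcosets W"
    using D H_carrier[OF h(1)] W by (auto simp: X_def LCOSETS_def lcos_m_assoc subgroup.subset)
  moreover have "v <# (h <# D) = h <# D" if v: "v \<in> V" for v
  proof -
    \<comment> \<open>Normality moves \<open>v\<close> past \<open>h\<close> at the cost of
      replacing it by another element of \<open>V\<close>.\<close>
    have "v \<otimes> h \<in> V #> h"
      using v by (auto simp: r_coset_def)
    then obtain v' where v': "v' \<in> V" "v \<otimes> h = h \<otimes> v'"
      unfolding coset_commute[OF h(1)] by (auto simp: l_coset_def)
    have "v <# (h <# D) = h <# (v' <# D)"
      using v v' h D X_subset by (simp add: lcos_m_assoc H_carrier V_carrier)
    then show ?thesis
      using v' D by (simp add: X_def)
  qed
  ultimately show ?thesis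
    unfolding h(2) coset_act[OF h(1) D] by (simp add: X_def)
qed

lemma act_one: "D \<in> X \<Longrightarrow> \<one>\<^bsub>K\<^esub> <#> D = D"
proof -
  assume D: "D \<in> X"
  have "\<one> \<in> H"
    using H by (rule subgroup.one_closed)
  moreover have "\<one> <# V = V"
    using V_carrier by (intro lcos_mult_one) blast
  ultimately show ?thesis
    using coset_act[OF _ D, of \<one>] lcos_mult_one[OF X_subset[OF D]] by simp
qed

lemma K_subset: "\<kappa> \<in> carrier K \<Longrightarrow> \<kappa> \<subseteq> carrier G"
  using V_carrier H_carrier by (auto simp: carrier_K l_coset_def)

lemma act_mult:
  "\<kappa> \<in> carrier K \<Longrightarrow> \<kappa>' \<in> carrier K \<Longrightarrow> D \<in> X \<Longrightarrow> (\<kappa> \<otimes>\<^bsub>K\<^esub> \<kappa>') <#> D = \<kappa> <#> (\<kappa>' <#> D)"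
  using set_mult_assoc[OF K_subset K_subset X_subset] by simp

definition Stab :: "'a set \<Rightarrow> 'a set set" where
  "Stab D = {\<kappa> \<in> carrier K. \<kappa> <#> D = D}"

lemma subgroup_Stab: "D \<in> X \<Longrightarrow> subgroup (Stab D) K"
proof -
  assume D: "D \<in> X"
  interpret A: group_action K X "\<lambda>\<kappa>. restrict (\<lambda>D. \<kappa> <#> D) X"
    using act_closed act_one act_mult by (rule K.group_actionI)
  have "Stab D = stabilizer K (\<lambda>\<kappa>. restrict (\<lambda>D. \<kappa> <#> D) X) D"
    using D by (auto simp: Stab_def stabilizer_def)
  then show ?thesis
    using A.stabilizer_subgroup[OF D] by simp
qed

text \<open>Correspondence of subgroups: \<open>\<Union>L\<close> is the preimage of
  \<open>L\<close> in \<open>H\<close>. The elements of \<open>L\<close> are exactly the cosets of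
  \<open>V\<close> in this preimage, which gives the index formula.\<close>

lemma Union_subgroup:
  assumes L: "subgroup L K"
  shows "subgroup (\<Union>L) G" "V \<subseteq> \<Union>L" "\<Union>L \<subseteq> H" "h \<in> \<Union>L \<longleftrightarrow> h \<in> H \<and> h <# V \<in> L"
    "subgroup_index G V = subgroup_index G (\<Union>L) * card L"
proof -
  show sub: "subgroup (\<Union>L) G"
    using incl_subgroup[OF H N.factgroup_subgroup_union_subgroup[OF L]] .
  show VL: "V \<subseteq> \<Union>L"
    using subgroup.one_closed[OF L] by auto
  have char: "\<Union>L = {x \<in> H. x <# V \<in> L}"
    using N.factgroup_subgroup_union_char[OF L] by (auto simp: coset_commute)
  show "\<Union>L \<subseteq> H"
    by (auto simp: char)
  show "h \<in> \<Union>L \<longleftrightarrow> h \<in> H \<and> h <# V \<in> L"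
    by (simp add: char)
  have "lcosets\<^bsub>G\<lparr>carrier := \<Union>L\<rparr>\<^esub> V = (\<lambda>h. h <# V) ` \<Union>L"
    by (auto simp: LCOSETS_def)
  also have "\<dots> = L"
    using subgroup.subset[OF L] by (auto simp: char carrier_K image_iff)
  finally show "subgroup_index G V = subgroup_index G (\<Union>L) * card L"
    using subgroup_index_mult[OF subgroup_V sub VL] by (simp add: subgroup_index_def)
qed

text \<open>The stabilizer of \<open>D\<close> in \<open>G\<close> is a conjugate of
  \<open>W\<close> and has the index of \<open>W\<close>. It contains the preimage of
  \<open>Stab D\<close>, and \<open>e\<close> is the index of that preimage in it.\<close>

lemma index_Stab:
  assumes D: "D \<in> X"
  obtains e where "subgroup_index G V = subgroup_index G W * (e * card (Stab D))"
proof -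
  obtain x where x: "x \<in> carrier G" "D = x <# W"
    using D by (auto simp: X_def LCOSETS_def)
  define S where "S = x <# W #> inv x"
  have S: "subgroup S G" "subgroup_index G S = subgroup_index G W"
    unfolding S_def using x W
    by (simp_all add: subgroup_conjugation_is_surj2 subgroup_index_conjugate)
  have S_eq: "S = {g \<in> carrier G. g <# D = D}"
    unfolding S_def x(2) using coset_stabilizer_eq_conjugate[OF x(1) W] by simp
  note U = Union_subgroup[OF subgroup_Stab[OF D]]
  have "\<Union>(Stab D) \<subseteq> S"
  proof
    fix h assume "h \<in> \<Union>(Stab D)"
    then have h: "h \<in> H" "(h <# V) <#> D = D"
      unfolding U(4) by (simp_all add: Stab_def)
    then show "h \<in> S"
      using coset_act[OF h(1) D] H_carrier by (simp add: S_eq)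
  qed
  then show ?thesis
    using subgroup_index_mult[OF U(1) S(1)] U(5) S(2)
    by (intro that[of "subgroup_index (G\<lparr>carrier := S\<rparr>) (\<Union>(Stab D))"]) (simp add: mult.assoc)
qed

lemma card_Stab: "D \<in> X \<Longrightarrow> card (Stab D) > 0" "D \<in> X \<Longrightarrow> card (Stab D) dvd card (carrier K)"
proof -
  assume D: "D \<in> X"
  show "card (Stab D) > 0"
    using K.subgroupE(2)[OF subgroup_Stab[OF D]] finite_K
    by (auto simp: card_gt_0_iff Stab_def)
  show "card (Stab D) dvd card (carrier K)"
    using K.card_subgroup_dvd[OF K.subgroup_self subgroup_Stab[OF D]] by (auto simp: Stab_def)
qed

lemma phi_V: "phi G V W = card X"
  by (simp add: phi_def num_fixed_def X_def)

text \<open>The subgroup generated by \<open>V\<close> and a preimage of \<open>\<kappa>\<close>.\<close>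

definition cyc :: "'a set \<Rightarrow> 'a set" where
  "cyc \<kappa> = \<Union>(generate K {\<kappa>})"

lemma cyc:
  assumes \<kappa>: "\<kappa> \<in> carrier K"
  shows "subgroup (cyc \<kappa>) G" "V \<subseteq> cyc \<kappa>" "cyc \<kappa> \<subseteq> H"
    "subgroup_index G V = subgroup_index G (cyc \<kappa>) * K.ord \<kappa>"
    "phi G (cyc \<kappa>) W = card {D \<in> X. \<kappa> <#> D = D}"
proof -
  have gen: "subgroup (generate K {\<kappa>}) K"
    using \<kappa> by (intro K.generate_is_subgroup) auto
  note U = Union_subgroup[OF gen]
  show "subgroup (cyc \<kappa>) G" "cyc \<kappa> \<subseteq> H"
    "subgroup_index G V = subgroup_index G (cyc \<kappa>) * K.ord \<kappa>"
    using U(1,3,5) by (simp_all add: cyc_def K.generate_pow_card[OF \<kappa>])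
  show V: "V \<subseteq> cyc \<kappa>"
    using U(2) by (simp add: cyc_def)
  \<comment> \<open>For a coset fixed by \<open>V\<close>, invariance under \<kappa> suffices:
    \<open>Stab D\<close> is a subgroup and so contains everything generated by \<kappa>.\<close>
  have "(\<forall>s\<in>cyc \<kappa>. s <# D = D) \<longleftrightarrow> \<kappa> <#> D = D" if D: "D \<in> X" for D
  proof
    assume *: "\<forall>s\<in>cyc \<kappa>. s <# D = D"
    obtain h where h: "h \<in> H" "\<kappa> = h <# V"
      using \<kappa> by (auto simp: carrier_K)
    then have "h \<in> cyc \<kappa>"
      using U(4)[of h] generate.incl[of \<kappa> "{\<kappa>}" K] by (simp add: cyc_def)
    then show "\<kappa> <#> D = D"
      using * h coset_act D by simp
  next
    assume "\<kappa> <#> D = D"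
    then have "generate K {\<kappa>} \<subseteq> Stab D"
      using \<kappa> subgroup_Stab[OF D] by (intro K.generate_subgroup_incl) (auto simp: Stab_def)
    moreover have "s \<in> H" "s <# V \<in> generate K {\<kappa>}" if "s \<in> cyc \<kappa>" for s
      using that unfolding cyc_def U(4) by simp_all
    ultimately have "(s <# V) <#> D = D" if "s \<in> cyc \<kappa>" for s
      using that by (auto simp: Stab_def)
    then show "\<forall>s\<in>cyc \<kappa>. s <# D = D"
      using coset_act[OF _ D] \<open>\<And>s. s \<in> cyc \<kappa> \<Longrightarrow> s \<in> H\<close> by simp
  qed
  moreover have "D \<in> X" if "D \<in> lcosets W" "\<forall>s\<in>cyc \<kappa>. s <# D = D" for D
    using that V by (auto simp: X_def)
  moreover have "D \<in> lcosets W" if "D \<in> X" for D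
    using that by (simp add: X_def)
  ultimately have "{D \<in> lcosets W. \<forall>s\<in>cyc \<kappa>. s <# D = D} = {D \<in> X. \<kappa> <#> D = D}"
    by blast
  then show "phi G (cyc \<kappa>) W = card {D \<in> X. \<kappa> <#> D = D}"
    by (simp add: phi_def num_fixed_def)
qed

lemma cyc_one: "cyc \<one>\<^bsub>K\<^esub> = V"
  unfolding cyc_def K.generate_one by simp

text \<open>This will show that only the identity of \<open>K\<close> contributes to the coefficient
  of the unknown belonging to \<open>V\<close>.\<close>

lemma V_less_cyc:
  assumes "\<kappa> \<in> carrier K" "\<kappa> \<noteq> \<one>\<^bsub>K\<^esub>"
  shows "subgroup_index G (cyc \<kappa>) < subgroup_index G V"
proof -
  have "K.ord \<kappa> \<noteq> 1" "K.ord \<kappa> > 0"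
    using K.ord_eq_1[OF assms(1)] assms(2) K.ord_ge_1[OF finite_K assms(1)] by auto
  then show ?thesis
    using index_V cyc(4)[OF assms(1)] by (cases "K.ord \<kappa>"; cases "subgroup_index G (cyc \<kappa>)") auto
qed

text \<open>Burnside's lemma turns the sum into one over the stabilizers \<open>L\<close> of the points of \<open>X\<close>; the
  exponents in the part belonging to \<open>L\<close> are multiples of \<open>|L| / ord \<kappa>\<close>.\<close>

lemma card_dvd_sum_phi_power:
  fixes n :: int
  shows "int (card (carrier K)) dvd
    (\<Sum>\<kappa>\<in>carrier K. int (phi G (cyc \<kappa>) W) * n ^ rel_index G W (cyc \<kappa>))"
proof -
  let ?r = "\<lambda>\<kappa>. rel_index G W (cyc \<kappa>)"
  have index_cyc: "subgroup_index G (cyc \<kappa>) = subgroup_index G V div K.ord \<kappa>"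
    if "\<kappa> \<in> carrier K" for \<kappa>
    using cyc(4)[OF that] K.ord_ge_1[OF finite_K that] by simp
  \<comment> \<open>Pairs of a point and an element fixing it are first summed point by point.
    Exchanging the sums later yields, for each \<kappa>, the number of its fixed points, which is
    \<open>phi G (cyc \<kappa>) W\<close>.\<close>
  have "int (Coset.order K) dvd (\<Sum>D\<in>X. \<Sum>\<kappa>\<in>Stab D. n ^ ?r \<kappa>)"
  proof (rule K.order_dvd_sum_over_action[OF finite_X act_closed act_one act_mult])
    fix g D assume g: "g \<in> carrier K" and D: "D \<in> X"
    have conj: "g \<otimes>\<^bsub>K\<^esub> \<kappa> \<otimes>\<^bsub>K\<^esub> inv\<^bsub>K\<^esub> g \<in> Stab (g <#> D)"
      if "g \<in> carrier K" "D \<in> X" "\<kappa> \<in> Stab D" for g \<kappa> D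
      using that act_closed act_one act_mult[of "inv\<^bsub>K\<^esub> g" g D]
      by (simp add: Stab_def act_mult del: mult_FactGroup one_FactGroup)
    have cancel_act: "inv\<^bsub>K\<^esub> g <#> (g <#> D) = D"
      using act_mult[of "inv\<^bsub>K\<^esub> g" g D] act_one[OF D] g D
      by (simp del: mult_FactGroup one_FactGroup)
    have Stab_carrier: "\<kappa> \<in> carrier K" if "\<kappa> \<in> Stab D" for \<kappa> D
      using that by (simp add: Stab_def)
    have cancel: "g \<otimes>\<^bsub>K\<^esub> (inv\<^bsub>K\<^esub> g \<otimes>\<^bsub>K\<^esub> \<kappa>) = \<kappa>" "inv\<^bsub>K\<^esub> g \<otimes>\<^bsub>K\<^esub> (g \<otimes>\<^bsub>K\<^esub> \<kappa>) = \<kappa>"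
      if "\<kappa> \<in> carrier K" for \<kappa>
      using g that by (simp_all flip: K.m_assoc del: mult_FactGroup one_FactGroup)
    \<comment> \<open>Conjugation by \<open>g\<close> maps \<open>Stab D\<close> bijectively onto
      \<open>Stab (g <#> D)\<close>. It preserves orders, hence the indices of the groups
      \<open>cyc \<kappa>\<close> and the exponents.\<close>
    show "(\<Sum>\<kappa>\<in>Stab (g <#> D). n ^ ?r \<kappa>) = (\<Sum>\<kappa>\<in>Stab D. n ^ ?r \<kappa>)"
    proof (rule sum.reindex_bij_witness[where
          i = "\<lambda>\<kappa>. g \<otimes>\<^bsub>K\<^esub> \<kappa> \<otimes>\<^bsub>K\<^esub> inv\<^bsub>K\<^esub> g" and j = "\<lambda>\<kappa>. inv\<^bsub>K\<^esub> g \<otimes>\<^bsub>K\<^esub> \<kappa> \<otimes>\<^bsub>K\<^esub> g"])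
      fix \<kappa> assume \<kappa>: "\<kappa> \<in> Stab (g <#> D)"
      note c = Stab_carrier[OF \<kappa>]
      show "g \<otimes>\<^bsub>K\<^esub> (inv\<^bsub>K\<^esub> g \<otimes>\<^bsub>K\<^esub> \<kappa> \<otimes>\<^bsub>K\<^esub> g) \<otimes>\<^bsub>K\<^esub> inv\<^bsub>K\<^esub> g = \<kappa>"
        using g c cancel by (simp add: K.m_assoc del: mult_FactGroup one_FactGroup)
      show "inv\<^bsub>K\<^esub> g \<otimes>\<^bsub>K\<^esub> \<kappa> \<otimes>\<^bsub>K\<^esub> g \<in> Stab D"
        using conj[of "inv\<^bsub>K\<^esub> g" "g <#> D" \<kappa>] g \<kappa> D act_closed cancel_act
        by (simp del: mult_FactGroup one_FactGroup)
      have "K.ord (inv\<^bsub>K\<^esub> g \<otimes>\<^bsub>K\<^esub> \<kappa> \<otimes>\<^bsub>K\<^esub> g) = K.ord \<kappa>"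
        using K.ord_conjugate[of "inv\<^bsub>K\<^esub> g" \<kappa>] g c by (simp del: mult_FactGroup one_FactGroup)
      then show "n ^ ?r (inv\<^bsub>K\<^esub> g \<otimes>\<^bsub>K\<^esub> \<kappa> \<otimes>\<^bsub>K\<^esub> g) = n ^ ?r \<kappa>"
        using index_cyc[OF c] index_cyc[of "inv\<^bsub>K\<^esub> g \<otimes>\<^bsub>K\<^esub> \<kappa> \<otimes>\<^bsub>K\<^esub> g"] g c
        by (simp add: rel_index_def del: mult_FactGroup one_FactGroup)
    next
      fix \<kappa> assume \<kappa>: "\<kappa> \<in> Stab D"
      note c = Stab_carrier[OF \<kappa>]
      show "inv\<^bsub>K\<^esub> g \<otimes>\<^bsub>K\<^esub> (g \<otimes>\<^bsub>K\<^esub> \<kappa> \<otimes>\<^bsub>K\<^esub> inv\<^bsub>K\<^esub> g) \<otimes>\<^bsub>K\<^esub> g = \<kappa>"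
        using g c cancel by (simp add: K.m_assoc del: mult_FactGroup one_FactGroup)
      show "g \<otimes>\<^bsub>K\<^esub> \<kappa> \<otimes>\<^bsub>K\<^esub> inv\<^bsub>K\<^esub> g \<in> Stab (g <#> D)"
        using conj[OF g D \<kappa>] .
    qed
  next
    fix D assume D: "D \<in> X"
    obtain e where e: "subgroup_index G V = subgroup_index G W * (e * card (Stab D))"
      using index_Stab[OF D] .
    \<comment> \<open>With this exponent the summand is a power of \<open>n ^ e\<close>, so the
      inner sum is the colouring sum of the group \<open>Stab D\<close> with base
      \<open>n ^ e\<close>.\<close>
    have "?r \<kappa> = e * (card (Stab D) div K.ord \<kappa>)" if "\<kappa> \<in> Stab D" for \<kappa>
    proof -
      have \<kappa>: "\<kappa> \<in> carrier K"
        using that by (simp add: Stab_def)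
      have "generate K {\<kappa>} \<subseteq> Stab D"
        using that subgroup_Stab[OF D] by (intro K.generate_subgroup_incl) auto
      moreover have "subgroup (generate K {\<kappa>}) K"
        using \<kappa> by (intro K.generate_is_subgroup) auto
      ultimately have "card (generate K {\<kappa>}) dvd card (Stab D)"
        using K.card_subgroup_dvd subgroup_Stab[OF D] by blast
      then obtain f where f: "card (Stab D) = K.ord \<kappa> * f"
        by (auto simp: K.generate_pow_card[OF \<kappa>])
      have pos: "K.ord \<kappa> > 0"
        using K.ord_ge_1[OF finite_K \<kappa>] by simp
      have "subgroup_index G (cyc \<kappa>) = subgroup_index G W * (e * f)"
        unfolding index_cyc[OF \<kappa>] e f using pos by (simp add: ac_simps)
      then show ?thesis
        using index_W pos by (simp add: rel_index_def f)
    qed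
    then have "(\<Sum>\<kappa>\<in>Stab D. n ^ ?r \<kappa>) = (\<Sum>\<kappa>\<in>Stab D. (n ^ e) ^ (card (Stab D) div K.ord \<kappa>))"
      by (simp add: power_mult)
    then show "int (card {\<kappa> \<in> carrier K. \<kappa> <#> D = D}) dvd (\<Sum>\<kappa>\<in>Stab D. n ^ ?r \<kappa>)"
      using K.order_dvd_sum_power_ord_subgroup[OF finite_K subgroup_Stab[OF D], of "n ^ e"]
      by (simp add: Stab_def)
  qed
  also have "(\<Sum>D\<in>X. \<Sum>\<kappa>\<in>Stab D. n ^ ?r \<kappa>) =
      (\<Sum>\<kappa>\<in>carrier K. \<Sum>D | D \<in> X \<and> \<kappa> <#> D = D. n ^ ?r \<kappa>)"
    unfolding Stab_def using finite_X finite_K by (rule sum.swap_restrict)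
  also have "\<dots> = (\<Sum>\<kappa>\<in>carrier K. int (phi G (cyc \<kappa>) W) * n ^ ?r \<kappa>)"
    by (intro sum.cong refl) (simp add: cyc(5))
  finally show ?thesis
    by (simp add: Coset.order_def)
qed

text \<open>Here the factor \<open>p\<^sup>m\<^sup>-\<^sup>1\<close> of \<open>n\<^sup>m\<^sup>-\<^sup>1\<close> absorbs the \<open>p\<close>-part of a stabilizer of order dividing \<open>m\<close>.\<close>

lemma card_dvd_phi_power:
  fixes n :: int
  assumes p: "prime p" and pn: "int p dvd n"
    and b: "card (carrier K) = p ^ a * b" and pb: "\<not> p dvd b"
  shows "int (card (carrier K)) dvd int b * (int (phi G V W) * n ^ (rel_index G W V - 1))"
proof -
  let ?m = "rel_index G W V"
  \<comment> \<open>The summand is constant, so the sum is \<open>card X\<close>, that is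
    \<open>phi G V W\<close>, times it. Only the divisibility by stabilizer orders needs
    work.\<close>
  have "int (Coset.order K) dvd (\<Sum>D\<in>X. int b * n ^ (?m - 1))"
  proof (rule K.order_dvd_sum_over_action[OF finite_X act_closed act_one act_mult])
    fix D assume D: "D \<in> X"
    let ?s = "card (Stab D)"
    obtain e where e: "subgroup_index G V = subgroup_index G W * (e * ?s)"
      using index_Stab[OF D] .
    then have m: "?m = e * ?s" "e > 0"
      using index_W index_V by (auto simp: rel_index_def intro: gr0I)
    obtain c t where ct: "?s = p ^ c * t" "\<not> p dvd t"
      using card_Stab(1)[OF D] p by (metis multiplicity_decompose' neq0_conv not_prime_unit)
    \<comment> \<open>The part of the stabilizer order prime to \<open>p\<close> is absorbed by
      \<open>b\<close>, the corresponding part of the order of \<open>K\<close>.\<close>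
    have "coprime t (p ^ a)"
      using p ct(2) by (simp add: coprime_commute prime_imp_coprime)
    moreover have "t dvd p ^ a * b"
      using card_Stab(2)[OF D] ct(1) b by (metis dvd_mult_right)
    ultimately have t: "t dvd b"
      by (simp add: coprime_dvd_mult_right_iff)
    \<comment> \<open>The strict inequality pays for the 1 subtracted in the exponent: from
      \<open>c < p ^ c\<close> and \<open>p ^ c \<le> ?m\<close> follows
      \<open>c \<le> ?m - 1\<close>.\<close>
    have "c < p ^ c"
      using prime_gt_1_nat[OF p] by (simp add: power_gt_expt)
    also have "p ^ c \<le> ?m"
      using m ct card_Stab(1)[OF D] by (simp add: Suc_leI mult_le_mono[of 1 "e * t" "p ^ c" "p ^ c", simplified])
    finally have "int p ^ c dvd n ^ (?m - 1)"
      using pn by (intro dvd_trans[OF le_imp_power_dvd[of c "?m - 1"]] dvd_power_same) simp_all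
    then have "int ?s dvd n ^ (?m - 1) * int b"
      unfolding ct(1) of_nat_mult of_nat_power using t by (intro mult_dvd_mono) simp_all
    then show "int (card {\<kappa> \<in> carrier K. \<kappa> <#> D = D}) dvd int b * n ^ (?m - 1)"
      by (simp add: Stab_def mult.commute)
  qed (rule refl | assumption)+
  then show ?thesis
    by (simp add: phi_V Coset.order_def ac_simps)
qed

end

section \<open>Triangular matrices\<close>

lemma row_sum_eq:
  fixes A :: "'i \<Rightarrow> 'i \<Rightarrow> 'r::comm_ring_1"
  assumes "finite S" "S \<subseteq> I" "\<And>k. k \<in> I \<Longrightarrow> A i k \<noteq> 0 \<Longrightarrow> k \<in> S"
  shows "(\<Sum>k | k \<in> I \<and> A i k \<noteq> 0. A i k * f k) = (\<Sum>k\<in>S. A i k * f k)"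
  using assms by (intro sum.mono_neutral_left) auto

text \<open>Associativity \<open>A (B g) = (A B) g\<close> for a vector \<open>g\<close>. The outer
  sum on the right runs over a union of row supports of \<open>B\<close>; it is finite, but
  cancellation may make the support of the product row smaller.\<close>

lemma row_sum_assoc:
  fixes A B :: "'i \<Rightarrow> 'i \<Rightarrow> 'r::comm_ring_1"
  assumes A: "row_finite I A" and B: "row_finite I B" and i: "i \<in> I"
  shows "(\<Sum>k | k \<in> I \<and> A i k \<noteq> 0. A i k * (\<Sum>l | l \<in> I \<and> B k l \<noteq> 0. B k l * g l))
    = (\<Sum>l \<in> (\<Union>k\<in>{k \<in> I. A i k \<noteq> 0}. {l \<in> I. B k l \<noteq> 0}). mat_mult I A B i l * g l)"
proof -
  let ?S = "{k \<in> I. A i k \<noteq> 0}"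
  let ?T = "\<Union>k\<in>?S. {l \<in> I. B k l \<noteq> 0}"
  have fin: "finite ?S" "finite ?T"
    using A B i by (auto simp: row_finite_def)
  have "(\<Sum>k\<in>?S. A i k * (\<Sum>l | l \<in> I \<and> B k l \<noteq> 0. B k l * g l))
      = (\<Sum>k\<in>?S. \<Sum>l\<in>?T. A i k * B k l * g l)"
  proof (intro sum.cong refl)
    fix k assume k: "k \<in> ?S"
    have "(\<Sum>l | l \<in> I \<and> B k l \<noteq> 0. B k l * g l) = (\<Sum>l\<in>?T. B k l * g l)"
      using fin k by (intro row_sum_eq) auto
    then show "A i k * (\<Sum>l | l \<in> I \<and> B k l \<noteq> 0. B k l * g l) = (\<Sum>l\<in>?T. A i k * B k l * g l)"
      by (simp add: sum_distrib_left mult.assoc)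
  qed
  also have "\<dots> = (\<Sum>l\<in>?T. \<Sum>k\<in>?S. A i k * B k l * g l)"
    by (rule sum.swap)
  also have "\<dots> = (\<Sum>l\<in>?T. mat_mult I A B i l * g l)"
    by (simp add: mat_mult_def sum_distrib_right)
  finally show ?thesis .
qed

lemma inverse_row_sum:
  fixes A B :: "'i \<Rightarrow> 'i \<Rightarrow> 'r::comm_ring_1"
  assumes A: "row_finite I A" and B: "row_finite I B"
    and inv: "\<And>i j. i \<in> I \<Longrightarrow> j \<in> I \<Longrightarrow> mat_mult I A B i j = (if i = j then 1 else 0)"
    and i: "i \<in> I"
  shows "(\<Sum>k | k \<in> I \<and> A i k \<noteq> 0. A i k * (\<Sum>l | l \<in> I \<and> B k l \<noteq> 0. B k l * g l)) = g i"
proof -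
  let ?T = "\<Union>k\<in>{k \<in> I. A i k \<noteq> 0}. {l \<in> I. B k l \<noteq> 0}"
  have fin: "finite ?T"
    using A B i by (auto simp: row_finite_def)
  \<comment> \<open>Otherwise all terms of the diagonal entry of the product would vanish, although
    this entry is 1.\<close>
  have "i \<in> ?T"
  proof (rule ccontr)
    assume "i \<notin> ?T"
    then have "mat_mult I A B i i = 0"
      using i unfolding mat_mult_def by (intro sum.neutral) auto
    then show False
      using inv[OF i i] by simp
  qed
  have "(\<Sum>l\<in>?T. mat_mult I A B i l * g l) = (\<Sum>l\<in>?T. if l = i then g i else 0)"
    using inv[OF i] by (intro sum.cong refl) auto
  also have "\<dots> = g i"
    using fin \<open>i \<in> ?T\<close> by (simp only: sum.delta) simp
  finally show ?thesis
    unfolding row_sum_assoc[OF A B i] .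
qed

lemma is_mat_inverse_unique:
  fixes A B C :: "'i \<Rightarrow> 'i \<Rightarrow> 'r::comm_ring_1"
  assumes B: "is_mat_inverse I A B" and C: "is_mat_inverse I A C"
  shows "B = C"
proof (intro ext)
  fix i j
  show "B i j = C i j"
  proof (cases "i \<in> I \<and> j \<in> I")
    case True
    then have i: "i \<in> I" and j: "j \<in> I" by auto
    have fin: "row_finite I A" "row_finite I B" "row_finite I C"
      using B C by (auto simp: is_mat_inverse_def)
    have BA: "mat_mult I B A i j = (if i = j then 1 else 0)" if "i \<in> I" "j \<in> I" for i j
      using B that by (auto simp: is_mat_inverse_def)
    \<comment> \<open>The usual argument \<open>C = B (A C) = B\<close>, with column
      \<open>j\<close> of \<open>C\<close> as the vector.\<close>
    have "C i j = (\<Sum>k | k \<in> I \<and> B i k \<noteq> 0. B i k * (\<Sum>l | l \<in> I \<and> A k l \<noteq> 0. A k l * C l j))"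
      by (rule inverse_row_sum[OF fin(2,1) BA i, symmetric])
    also have "\<dots> = (\<Sum>k | k \<in> I \<and> B i k \<noteq> 0. B i k * (if k = j then 1 else 0))"
      using C j by (intro sum.cong refl) (auto simp: is_mat_inverse_def mat_mult_def)
    also have "\<dots> = B i j"
      using j fin(2) i by (auto simp: row_finite_def if_distrib sum.delta cong: if_cong)
    finally show ?thesis by simp
  next
    case False
    then show ?thesis
      using B C by (auto simp: is_mat_inverse_def)
  qed
qed

text \<open>The rank \<open>r\<close> makes elimination along a row well-founded even for infinite
  \<open>I\<close>. The entries will be polynomials, so the diagonal ones have to be units.\<close>

locale triangular_matrix =
  fixes I :: "'i set" and A :: "'i \<Rightarrow> 'i \<Rightarrow> 'r::comm_ring_1" and r :: "'i \<Rightarrow> nat"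
  assumes row_finite: "row_finite I A"
    and diag: "\<And>i. i \<in> I \<Longrightarrow> A i i dvd 1"
    and triangular: "\<And>i j. i \<in> I \<Longrightarrow> j \<in> I \<Longrightarrow> A i j \<noteq> 0 \<Longrightarrow> j = i \<or> r j < r i"
begin

abbreviation "S i \<equiv> {k \<in> I. A i k \<noteq> 0 \<and> k \<noteq> i}"

lemma finite_S: "i \<in> I \<Longrightarrow> finite (S i)"
  by (rule finite_subset[of _ "{k \<in> I. A i k \<noteq> 0}"]) (use row_finite in \<open>auto simp: row_finite_def\<close>)

lemma row_split:
  assumes i: "i \<in> I"
  shows "(\<Sum>k | k \<in> I \<and> A i k \<noteq> 0. A i k * f k) = A i i * f i + (\<Sum>k\<in>S i. A i k * f k)"
proof -
  have "(\<Sum>k | k \<in> I \<and> A i k \<noteq> 0. A i k * f k) = (\<Sum>k\<in>insert i (S i). A i k * f k)"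
    using i finite_S[OF i] by (intro row_sum_eq) auto
  then show ?thesis
    using finite_S[OF i] by simp
qed

text \<open>Forward substitution: the equation \<open>A B = 1\<close> determines row
  \<open>i\<close> of \<open>B\<close> from the rows of smaller rank. The same recursion gives
  \<open>B A = 1\<close> by induction on the rank.\<close>

lemma inverse_exists: "\<exists>B. is_mat_inverse I A B"
proof -
  define u where "u = (\<lambda>i. SOME x. x * A i i = 1)"
  have u: "u i * A i i = 1" if "i \<in> I" for i
    unfolding u_def by (rule someI_ex) (metis diag[OF that] dvdE mult.commute)
  define F where "F = (\<lambda>f i j. if i \<in> I \<and> j \<in> I
      then u i * ((if i = j then 1 else 0) - (\<Sum>k\<in>S i. A i k * f k j)) else 0)"
  \<comment> \<open>The recursion is on the row index alone and produces whole rows.\<close>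
  define B where "B = wfrec (inv_image less_than r) F"
  have B: "B i = F B i" for i
  proof -
    have "B i = F (cut B (inv_image less_than r) i) i"
      unfolding B_def by (rule wfrec) simp
    moreover have "cut B (inv_image less_than r) i k = B k" if "i \<in> I" "k \<in> S i" for k
      using triangular[of i k] that by (auto simp: cut_def)
    then have "F (cut B (inv_image less_than r) i) i = F B i"
      unfolding F_def by (intro ext if_cong refl arg_cong2[where f = "(*)"]
        arg_cong2[where f = "(-)"] sum.cong) auto
    ultimately show ?thesis by simp
  qed
  have B_eq: "B i j = u i * ((if i = j then 1 else 0) - (\<Sum>k\<in>S i. A i k * B k j))"
    if "i \<in> I" "j \<in> I" for i j
    using B[of i] that by (simp add: F_def fun_eq_iff)
  have B_outside: "B i j = 0" if "i \<notin> I \<or> j \<notin> I" for i j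
    using B[of i] that by (auto simp: F_def fun_eq_iff)
  have fin: "finite {j \<in> I. B i j \<noteq> 0}" if "i \<in> I" for i
    using that
  proof (induction "r i" arbitrary: i rule: less_induct)
    case less
    have "B i j = 0" if "j \<in> I" "j \<noteq> i" "j \<notin> (\<Union>k\<in>S i. {j \<in> I. B k j \<noteq> 0})" for j
    proof -
      have "(\<Sum>k\<in>S i. A i k * B k j) = 0"
        using that by (intro sum.neutral) auto
      then show ?thesis
        using B_eq[OF less.prems that(1)] that(2) by simp
    qed
    then have "{j \<in> I. B i j \<noteq> 0} \<subseteq> insert i (\<Union>k\<in>S i. {j \<in> I. B k j \<noteq> 0})"
      by blast
    moreover have "finite (\<Union>k\<in>S i. {j \<in> I. B k j \<noteq> 0})"
      using finite_S less triangular by auto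
    ultimately show ?case
      using finite_subset by blast
  qed
  have row_B: "row_finite I B"
    using fin by (simp add: row_finite_def)
  have AB: "mat_mult I A B i j = (if i = j then 1 else 0)" if "i \<in> I" "j \<in> I" for i j
  proof -
    have "A i i * B i j = (u i * A i i) * ((if i = j then 1 else 0) - (\<Sum>k\<in>S i. A i k * B k j))"
      using B_eq[OF that] by (simp only: ac_simps)
    then show ?thesis
      unfolding mat_mult_def row_split[OF that(1)] u[OF that(1)] by simp
  qed
  have BA: "mat_mult I B A i j = (if i = j then 1 else 0)" if "i \<in> I" "j \<in> I" for i j
    using that
  proof (induction "r i" arbitrary: i rule: less_induct)
    case less
    note i = less.prems(1) and j = less.prems(2)
    \<comment> \<open>One finite set supports all rows of \<open>B\<close> that occur, so the sums
      over \<open>k\<close> and \<open>l\<close> can be exchanged.\<close>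
    let ?T = "insert i ({k \<in> I. B i k \<noteq> 0} \<union> (\<Union>k\<in>S i. {l \<in> I. B k l \<noteq> 0}))"
    have T: "finite ?T" "?T \<subseteq> I"
      using fin i finite_S[OF i] by auto
    have sum_T: "mat_mult I B A k j = (\<Sum>l\<in>?T. B k l * A l j)" if "k \<in> insert i (S i)" for k
      unfolding mat_mult_def using T that by (intro row_sum_eq) auto
    have "mat_mult I B A i j = (\<Sum>l\<in>?T. u i * ((if i = l then A l j else 0)
        - (\<Sum>k\<in>S i. A i k * (B k l * A l j))))"
      unfolding sum_T[OF insertI1]
    proof (intro sum.cong refl)
      fix l assume "l \<in> ?T"
      then have l: "l \<in> I"
        using T(2) by blast
      show "B i l * A l j = u i * ((if i = l then A l j else 0) - (\<Sum>k\<in>S i. A i k * (B k l * A l j)))"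
      proof -
        have "(\<Sum>k\<in>S i. A i k * (B k l * A l j)) = (\<Sum>k\<in>S i. A i k * B k l) * A l j"
          by (simp add: sum_distrib_right mult.assoc)
        then show ?thesis
          unfolding B_eq[OF i l] by (simp add: algebra_simps)
      qed
    qed
    also have "\<dots> = u i * (A i j - (\<Sum>k\<in>S i. A i k * (\<Sum>l\<in>?T. B k l * A l j)))"
      unfolding sum_distrib_left[symmetric] sum_subtractf sum.swap[of _ _ ?T]
      using T by (simp add: sum.delta' sum_distrib_left)
    also have "(\<Sum>k\<in>S i. A i k * (\<Sum>l\<in>?T. B k l * A l j)) = (\<Sum>k\<in>S i. if k = j then A i k else 0)"
    proof (intro sum.cong refl)
      fix k assume k: "k \<in> S i"
      then have "mat_mult I B A k j = (if k = j then 1 else 0)"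
        using triangular[OF i, of k] by (intro less.hyps j) auto
      then show "A i k * (\<Sum>l\<in>?T. B k l * A l j) = (if k = j then A i k else 0)"
        unfolding sum_T[OF insertI2[OF k]] by (simp only:) simp
    qed
    \<comment> \<open>The set \<open>S i\<close> omits \<open>i\<close>, which leaves
      \<open>A i i\<close> when \<open>i = j\<close>. For other \<open>j\<close> outside
      \<open>S i\<close> the entry \<open>A i j\<close> is 0 anyway.\<close>
    also have "\<dots> = (if i = j then 0 else A i j)"
      using finite_S[OF i] j by (simp add: sum.delta)
    finally show ?case
      using u[OF i] by auto
  qed
  show ?thesis
    unfolding is_mat_inverse_def using row_finite row_B B_outside AB BA by blast
qed

lemma is_mat_inverse_mat_inverse: "is_mat_inverse I A (mat_inverse I A)"
  unfolding mat_inverse_def using inverse_exists is_mat_inverse_unique by (metis theI)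

text \<open>By the recursion, a nonzero entry of the inverse off the diagonal comes from a nonzero
  \<open>A i k\<close> and a nonzero entry of row \<open>k\<close>, which has smaller rank. Later
  \<open>P\<close> is the order of classes.\<close>

lemma mat_inverse_support:
  assumes refl: "\<And>i. i \<in> I \<Longrightarrow> P i i"
    and step: "\<And>i j k. i \<in> I \<Longrightarrow> k \<in> I \<Longrightarrow> j \<in> I \<Longrightarrow> A i k \<noteq> 0 \<Longrightarrow> P k j \<Longrightarrow> P i j"
    and ij: "i \<in> I" "j \<in> I" "mat_inverse I A i j \<noteq> 0"
  shows "P i j"
  using ij
proof (induction "r i" arbitrary: i rule: less_induct)
  case less
  let ?B = "mat_inverse I A"
  note i = less.prems(1) and j = less.prems(2)
  show ?case
  proof (rule ccontr)
    assume "\<not> P i j"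
    then have "i \<noteq> j"
      using refl i by blast
    have "?B k j = 0" if "k \<in> S i" for k
      using that less.hyps[of k] step[OF i, of k j] triangular[OF i, of k] j \<open>\<not> P i j\<close> by auto
    then have "(\<Sum>k\<in>S i. A i k * ?B k j) = 0"
      by (intro sum.neutral) auto
    moreover have "mat_mult I A ?B i j = 0"
      using is_mat_inverse_mat_inverse i j \<open>i \<noteq> j\<close> by (simp add: is_mat_inverse_def)
    ultimately have "A i i * ?B i j = 0"
      unfolding mat_mult_def row_split[OF i] by simp
    moreover obtain u where "1 = A i i * u"
      using diag[OF i] by (rule dvdE)
    ultimately have "?B i j = 0"
      by (metis mult.assoc mult.commute mult_1 mult_zero_right)
    then show False
      using less.prems(3) by simp
  qed
qed

text \<open>This turns a formula involving the inverse into a linear system with matrix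
  \<open>A\<close>.\<close>

lemma mat_inverse_solves:
  assumes i: "i \<in> I"
  shows "(\<Sum>k | k \<in> I \<and> A i k \<noteq> 0. A i k *
    (\<Sum>l | l \<in> I \<and> mat_inverse I A k l \<noteq> 0. mat_inverse I A k l * g l)) = g i"
  using is_mat_inverse_mat_inverse
  by (intro inverse_row_sum row_finite i) (auto simp: is_mat_inverse_def)

end

section \<open>Normalizers and open subgroups\<close>

text \<open>The relative index is 1, so \<open>A\<close> is the only coset of \<open>A\<close> in
  \<open>B\<close>. Positivity expresses finiteness, because infinite indices are 0.\<close>

lemma (in group) subgroup_eq_of_index_eq:
  assumes A: "subgroup A G" and B: "subgroup B G" and AB: "A \<subseteq> B"
    and index: "subgroup_index G A = subgroup_index G B" "subgroup_index G B > 0"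
  shows "A = B"
proof -
  have "card (lcosets\<^bsub>G\<lparr>carrier := B\<rparr>\<^esub> A) = 1"
    using subgroup_index_mult[OF A B AB] index by (simp add: subgroup_index_def)
  then obtain C where C: "lcosets\<^bsub>G\<lparr>carrier := B\<rparr>\<^esub> A = {C}"
    by (auto simp: card_1_singleton_iff)
  have coset: "b <# A = C" if "b \<in> B" for b
    using C that by (auto simp: LCOSETS_def)
  have "\<one> <# A = A"
    using subgroup.subset[OF A] by (rule lcos_mult_one)
  then have "C = A"
    using coset[OF subgroup.one_closed[OF B]] by simp
  then have "B \<subseteq> A"
    using coset lcos_self[OF _ A] subgroup.subset[OF B] by blast
  with AB show ?thesis by blast
qed

lemma (in group) index_of_conj_le:
  assumes S: "subgroup S G" and V: "subgroup V G" and le: "conj_le G S V"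
  shows "subgroup_index G S dvd subgroup_index G V"
    and "subgroup_index G V = subgroup_index G S \<Longrightarrow> subgroup_index G S > 0 \<Longrightarrow>
      \<exists>g\<in>carrier G. V = g <# S #> inv g"
proof -
  obtain g where g: "g \<in> carrier G" "V \<subseteq> g <# S #> inv g"
    using le by (auto simp: conj_le_def)
  have S': "subgroup (g <# S #> inv g) G"
    using g S by (simp add: subgroup_conjugation_is_surj2)
  have index: "subgroup_index G (g <# S #> inv g) = subgroup_index G S"
    using g S by (simp add: subgroup_index_conjugate)
  show "subgroup_index G S dvd subgroup_index G V"
    using subgroup_index_mult[OF V S' g(2)] index by simp
  show "\<exists>g\<in>carrier G. V = g <# S #> inv g"
    if "subgroup_index G V = subgroup_index G S" "subgroup_index G S > 0"
    using subgroup_eq_of_index_eq[OF V S' g(2)] index that g(1) by auto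
qed

lemma (in group) fixed_coset_iff:
  assumes "x \<in> carrier G" "subgroup W G" "S \<subseteq> carrier G"
  shows "(\<forall>s\<in>S. s <# (x <# W) = x <# W) \<longleftrightarrow> S \<subseteq> x <# W #> inv x"
  using assms by (auto simp flip: coset_stabilizer_eq_conjugate)

text \<open>A fixed coset \<open>x <# W\<close> puts \<open>S\<close> into the conjugate of
  \<open>W\<close> by \<open>x\<close>. Hence the order conditions attached to the monomials only
  exclude terms that vanish.\<close>

lemma (in group) conj_le_of_phi:
  assumes "subgroup W G" "S \<subseteq> carrier G" "phi G S W \<noteq> 0"
  shows "conj_le G W S"
proof -
  have "{D \<in> lcosets W. \<forall>s\<in>S. s <# D = D} \<noteq> {}"
    using assms(3) unfolding phi_def num_fixed_def by (metis card.empty)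
  then obtain x where "x \<in> carrier G" "\<forall>s\<in>S. s <# (x <# W) = x <# W"
    by (auto simp: LCOSETS_def)
  then show ?thesis
    using fixed_coset_iff assms by (auto simp: conj_le_def)
qed

lemma (in group) conj_le_refl: "S \<subseteq> carrier G \<Longrightarrow> conj_le G S S"
  unfolding conj_le_def by (rule bexI[of _ \<one>]) (simp_all only: conjugate_one, simp_all)

lemma (in group) conj_le_trans:
  assumes "conj_le G A B" "conj_le G B C" "A \<subseteq> carrier G"
  shows "conj_le G A C"
proof -
  obtain g h where gh: "g \<in> carrier G" "B \<subseteq> g <# A #> inv g" "h \<in> carrier G" "C \<subseteq> h <# B #> inv h"
    using assms by (auto simp: conj_le_def)
  then have "C \<subseteq> h <# (g <# A #> inv g) #> inv h"
    unfolding conjugate_eq_image by blast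
  then show ?thesis
    using gh assms(3) unfolding conj_le_def
    by (intro bexI[of _ "h \<otimes> g"]) (simp_all add: conjugate_conjugate)
qed

lemma (in group) rep_conj_class:
  assumes H: "H \<subseteq> carrier G"
  obtains g where "g \<in> carrier G" "rep (conj_class G H) = g <# H #> inv g"
proof -
  have "H \<in> conj_class G H"
    using conjugate_one[OF H] unfolding conj_class_def by (intro CollectI exI[of _ \<one>]) simp
  then have "rep (conj_class G H) \<in> conj_class G H"
    unfolding rep_def by (rule someI)
  then show ?thesis
    using that by (auto simp: conj_class_def)
qed

lemma (in group) conj_class_conjugate:
  assumes g: "g \<in> carrier G" and H: "H \<subseteq> carrier G"
  shows "conj_class G (g <# H #> inv g) = conj_class G H"
proof -
  have "{h <# (g <# H #> inv g) #> inv h | h. h \<in> carrier G}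
      = {(h \<otimes> g) <# H #> inv (h \<otimes> g) | h. h \<in> carrier G}"
    using conjugate_conjugate[OF _ g H] by (intro Collect_cong) (metis (no_types))
  also have "\<dots> = {h <# H #> inv h | h. h \<in> carrier G}"
  proof (intro Collect_cong iffI; clarify)
    fix h assume "h \<in> carrier G"
    moreover from this have "h = (h \<otimes> inv g) \<otimes> g"
      using g by (simp add: m_assoc)
    ultimately show "\<exists>h'. h <# H #> inv h = (h' \<otimes> g) <# H #> inv (h' \<otimes> g) \<and> h' \<in> carrier G"
      using g by (intro exI[of _ "h \<otimes> inv g"]) (metis inv_closed m_closed)
  qed (use g in blast)
  finally show ?thesis
    unfolding conj_class_def .
qed

text \<open>The subtraction is truncated, so the relative index must be positive. It is whenever a
  fixed point exists; otherwise both sides are 0.\<close>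

lemma (in group) phi_power:
  fixes n :: int
  assumes S: "subgroup S G" and A: "subgroup A G" and index: "subgroup_index G A > 0"
  shows "int (phi G A S) * n ^ (rel_index G S A - 1) * n = int (phi G A S) * n ^ rel_index G S A"
proof (cases "phi G A S = 0")
  case False
  have "subgroup_index G S dvd subgroup_index G A"
    using index_of_conj_le(1)[OF S A conj_le_of_phi[OF S subgroup.subset[OF A] False]] .
  then have "rel_index G S A > 0"
    using index by (auto simp: rel_index_def elim!: dvdE)
  then show ?thesis
    by (cases "rel_index G S A") simp_all
qed simp

section \<open>Normalizers and self-fixed cosets\<close>

definition normalizing :: "('a, 'b) monoid_scheme \<Rightarrow> 'a set \<Rightarrow> 'a set" where
  "normalizing G V = {g \<in> carrier G. g <#\<^bsub>G\<^esub> V #>\<^bsub>G\<^esub> inv\<^bsub>G\<^esub> g = V}"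

lemma (in group) subgroup_normalizing:
  assumes V: "subgroup V G"
  shows "subgroup (normalizing G V) G" "V \<lhd> (G\<lparr>carrier := normalizing G V\<rparr>)"
proof -
  interpret V: subgroup V G by fact
  have conj: "g <# V #> inv g = V \<longleftrightarrow> g <# V = V #> g" if g: "g \<in> carrier G" for g
  proof
    assume "g <# V #> inv g = V"
    then have "(g <# V #> inv g) #> g = V #> g" by simp
    then show "g <# V = V #> g"
      using g by (simp add: coset_mult_assoc l_coset_subset_G V.subset)
  next
    assume "g <# V = V #> g"
    then show "g <# V #> inv g = V"
      using g by (simp add: coset_mult_assoc V.subset)
  qed
  show *: "subgroup (normalizing G V) G"
  proof (rule subgroupI)
    show "normalizing G V \<noteq> {}"
      using conjugate_one[OF V.subset] by (auto simp: normalizing_def)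
    show "inv a \<in> normalizing G V" if "a \<in> normalizing G V" for a
      using that conjugate_conjugate[OF _ _ V.subset, of "inv a" a] conjugate_one[OF V.subset]
      by (simp add: normalizing_def)
    show "a \<otimes> b \<in> normalizing G V" if "a \<in> normalizing G V" "b \<in> normalizing G V" for a b
      using that conjugate_conjugate[OF _ _ V.subset, of a b]
      by (simp add: normalizing_def)
  qed (auto simp: normalizing_def)
  interpret N: group "G\<lparr>carrier := normalizing G V\<rparr>"
    using subgroup.subgroup_is_group[OF * is_group] .
  have "V \<subseteq> normalizing G V"
  proof
    fix v assume v: "v \<in> V"
    then have "v <# V = V" "V #> v = V"
      using coset_join2[OF _ V] coset_join3[OF _ V] by auto
    then have "v <# V #> inv v = V"
      using conj[OF V.mem_carrier[OF v]] by blast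
    then show "v \<in> normalizing G V"
      using v by (simp add: normalizing_def)
  qed
  then show "V \<lhd> (G\<lparr>carrier := normalizing G V\<rparr>)"
    using conj by (intro N.normalI subgroup_incl V *) (auto simp: normalizing_def)
qed

text \<open>A conjugate of \<open>V\<close> containing \<open>V\<close> is equal to \<open>V\<close>, because the index is finite.\<close>

lemma (in group) phi_self:
  assumes V: "subgroup V G" and index: "subgroup_index G V > 0"
  shows "phi G V V = card (carrier ((G\<lparr>carrier := normalizing G V\<rparr>) Mod V))"
proof -
  interpret N: normal V "G\<lparr>carrier := normalizing G V\<rparr>"
    by (rule subgroup_normalizing[OF V])
  have "V \<subseteq> x <# V #> inv x \<longleftrightarrow> x \<in> normalizing G V" if x: "x \<in> carrier G" for x
    using subgroup_eq_of_index_eq[OF V subgroup_conjugation_is_surj2[OF x V]]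
      subgroup_index_conjugate[OF x V] x index by (auto simp: normalizing_def)
  then have fixed: "(\<forall>s\<in>V. s <# (x <# V) = x <# V) \<longleftrightarrow> x \<in> normalizing G V" if "x \<in> carrier G" for x
    using fixed_coset_iff[OF that V subgroup.subset[OF V]] that by blast
  have "{D \<in> lcosets V. \<forall>s\<in>V. s <# D = D} = (\<lambda>x. x <# V) ` normalizing G V"
  proof (intro subset_antisym subsetI)
    fix D assume D: "D \<in> {D \<in> lcosets V. \<forall>s\<in>V. s <# D = D}"
    then obtain x where "x \<in> carrier G" "D = x <# V"
      by (auto simp: LCOSETS_def)
    then show "D \<in> (\<lambda>x. x <# V) ` normalizing G V"
      using D fixed by simp
  next
    fix D assume "D \<in> (\<lambda>x. x <# V) ` normalizing G V"
    then obtain x where x: "x \<in> normalizing G V" "D = x <# V" "x \<in> carrier G"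
      by (auto simp: normalizing_def)
    then show "D \<in> {D \<in> lcosets V. \<forall>s\<in>V. s <# D = D}"
      using fixed[OF x(3)] lcosetsI[OF x(3)] by simp
  qed
  also have "\<dots> = carrier ((G\<lparr>carrier := normalizing G V\<rparr>) Mod V)"
    unfolding carrier_FactGroup using N.coset_eq by simp
  finally show ?thesis
    by (simp add: phi_def num_fixed_def)
qed

section \<open>Translations and open subgroups of topological groups\<close>

context topological_group
begin

lemma continuous_map_left_translation:
  assumes "g \<in> carrier G"
  shows "continuous_map T T (\<lambda>x. g \<otimes> x)"
proof -
  have "continuous_map T (prod_topology T T) (\<lambda>x. (g, x))"
    using assms by (simp add: continuous_map_pairwise o_def topspace_eq)
  then show ?thesis
    using continuous_map_compose[OF _ continuous_mult] by (fastforce simp: o_def)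
qed

lemma continuous_map_right_translation:
  assumes "g \<in> carrier G"
  shows "continuous_map T T (\<lambda>x. x \<otimes> g)"
proof -
  have "continuous_map T (prod_topology T T) (\<lambda>x. (x, g))"
    using assms by (simp add: continuous_map_pairwise o_def topspace_eq)
  then show ?thesis
    using continuous_map_compose[OF _ continuous_mult] by (fastforce simp: o_def)
qed

lemma openin_l_coset:
  assumes H: "openin T H" and g: "g \<in> carrier G"
  shows "openin T (g <# H)"
proof -
  have sub: "H \<subseteq> carrier G"
    using openin_subset[OF H] by (simp add: topspace_eq)
  have "g <# H = {x \<in> topspace T. inv g \<otimes> x \<in> H}"
  proof (intro subset_antisym subsetI)
    fix x assume "x \<in> g <# H"
    then obtain h where "h \<in> H" "x = g \<otimes> h"
      by (auto simp: l_coset_def)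
    then show "x \<in> {x \<in> topspace T. inv g \<otimes> x \<in> H}"
      using g sub by (auto simp: topspace_eq subset_iff simp flip: m_assoc)
  next
    fix x assume x: "x \<in> {x \<in> topspace T. inv g \<otimes> x \<in> H}"
    then have "x = g \<otimes> (inv g \<otimes> x)"
      using g by (simp add: topspace_eq flip: m_assoc)
    then show "x \<in> g <# H"
      using x by (auto simp: l_coset_def)
  qed
  then show ?thesis
    using openin_continuous_map_preimage[OF continuous_map_left_translation H, of "inv g"] g by simp
qed

lemma openin_r_coset:
  assumes H: "openin T H" and g: "g \<in> carrier G"
  shows "openin T (H #> g)"
proof -
  have sub: "H \<subseteq> carrier G"
    using openin_subset[OF H] by (simp add: topspace_eq)
  have "H #> g = {x \<in> topspace T. x \<otimes> inv g \<in> H}"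
  proof (intro subset_antisym subsetI)
    fix x assume "x \<in> H #> g"
    then obtain h where "h \<in> H" "x = h \<otimes> g"
      by (auto simp: r_coset_def)
    then show "x \<in> {x \<in> topspace T. x \<otimes> inv g \<in> H}"
      using g sub by (auto simp: topspace_eq subset_iff m_assoc)
  next
    fix x assume x: "x \<in> {x \<in> topspace T. x \<otimes> inv g \<in> H}"
    then have "x = (x \<otimes> inv g) \<otimes> g"
      using g by (simp add: topspace_eq m_assoc)
    then show "x \<in> H #> g"
      using x by (auto simp: r_coset_def)
  qed
  then show ?thesis
    using openin_continuous_map_preimage[OF continuous_map_right_translation H, of "inv g"] g by simp
qed

lemma open_subgroup_conjugate:
  assumes "open_subgroup G T H" "g \<in> carrier G"
  shows "open_subgroup G T (g <# H #> inv g)"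
  using assms
  by (simp add: open_subgroup_def subgroup_conjugation_is_surj2 openin_l_coset openin_r_coset)

text \<open>The group \<open>A\<close> is a union of translates of \<open>V\<close>. This makes the
  groups \<open>cyc \<kappa>\<close> open.\<close>

lemma open_subgroup_supergroup:
  assumes V: "open_subgroup G T V" and A: "subgroup A G" and VA: "V \<subseteq> A"
  shows "open_subgroup G T A"
proof -
  have sub: "subgroup V G"
    using V by (simp add: open_subgroup_def)
  have "A = (\<Union>a\<in>A. a <# V)"
  proof (intro subset_antisym subsetI)
    fix x assume "x \<in> A"
    then show "x \<in> (\<Union>a\<in>A. a <# V)"
      using lcos_self[OF _ sub, of x] subgroup.subset[OF A] by blast
  qed (use VA subgroup.m_closed[OF A] in \<open>auto simp: l_coset_def\<close>)
  moreover have "openin T (a <# V)" if "a \<in> A" for a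
    using that V subgroup.subset[OF A] by (intro openin_l_coset) (auto simp: open_subgroup_def)
  ultimately have "openin T A"
    by (metis (no_types, lifting) openin_Union imageE)
  with A show ?thesis
    by (simp add: open_subgroup_def)
qed

end

text \<open>The cosets form an open cover by disjoint nonempty sets; a finite subcover, given by
  compactness, must contain them all.\<close>

lemma (in profinite_group) open_subgroup_index_pos:
  assumes H: "open_subgroup G T H"
  shows "subgroup_index G H > 0"
proof -
  have sub: "subgroup H G" and op: "openin T H"
    using H by (simp_all add: open_subgroup_def)
  have "\<forall>D\<in>lcosets H. openin T D"
    using openin_l_coset[OF op] by (auto simp: LCOSETS_def)
  then obtain F where F: "finite F" "F \<subseteq> lcosets H" "carrier G \<subseteq> \<Union>F"
    using compact lcosets_part_G[OF sub] unfolding compact_space_def compactin_def topspace_eq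
    by (metis order_refl)
  have "D \<in> F" if D: "D \<in> lcosets H" for D
  proof -
    obtain x where x: "x \<in> carrier G" "D = x <# H"
      using D by (auto simp: LCOSETS_def)
    then obtain E where E: "E \<in> F" "x \<in> E"
      using F(3) by blast
    have "x \<in> D"
      using x lcos_self[OF x(1) sub] by simp
    then have "D = E"
      using lcos_disjoint[OF sub D, of E] E F(2) by blast
    with E show ?thesis by simp
  qed
  then have "finite (lcosets H)"
    using F by (metis finite_subset subsetI)
  moreover have "H \<in> lcosets H"
    using lcosetsI[of \<one> G H] lcos_mult_one[OF subgroup.subset[OF sub]] by simp
  ultimately show ?thesis
    by (auto simp: subgroup_index_def card_gt_0_iff)
qed

section \<open>Integrality\<close>

text \<open>For prime \<open>p\<close> this is membership in the localization of the integers at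
  \<open>p\<close>.\<close>

definition p_integral :: "nat \<Rightarrow> rat \<Rightarrow> bool" where
  "p_integral p x \<longleftrightarrow> (\<exists>m::int. \<not> int p dvd m \<and> of_int m * x \<in> \<int>)"

lemma p_integral_of_int: "prime p \<Longrightarrow> p_integral p (of_int c)"
  unfolding p_integral_def by (rule exI[of _ 1]) (auto simp: prime_nat_iff)

lemma p_integral_diff:
  assumes p: "prime p" and "p_integral p x" "p_integral p y"
  shows "p_integral p (x - y)"
proof -
  obtain k m :: int where k: "\<not> int p dvd k" "of_int k * x \<in> \<int>" and m: "\<not> int p dvd m" "of_int m * y \<in> \<int>"
    using assms by (auto simp: p_integral_def)
  have "of_int (k * m) * (x - y) = of_int m * (of_int k * x) - of_int k * (of_int m * y)"
    by (simp add: algebra_simps)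
  also have "\<dots> \<in> \<int>"
    by (intro Ints_diff Ints_mult[OF Ints_of_int k(2)] Ints_mult[OF Ints_of_int m(2)])
  finally show ?thesis
    using k m p unfolding p_integral_def
    by (intro exI[of _ "k * m"]) (simp add: prime_dvd_mult_iff)
qed

lemma p_integral_mult_int:
  assumes "p_integral p x"
  shows "p_integral p (of_int c * x)"
proof -
  obtain k :: int where "\<not> int p dvd k" "of_int k * x \<in> \<int>"
    using assms by (auto simp: p_integral_def)
  then show ?thesis
    unfolding p_integral_def
    by (intro exI[of _ k]) (auto simp: mult.left_commute intro!: Ints_mult)
qed

lemma p_integral_sum:
  assumes p: "prime p" and "\<And>i. i \<in> F \<Longrightarrow> p_integral p (x i)"
  shows "p_integral p (\<Sum>i\<in>F. x i)"
  using assms(2)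
proof (induction F rule: infinite_finite_induct)
  case (insert i F)
  \<comment> \<open>Addition is expressed by two subtractions, \<open>x - (0 - y)\<close>.\<close>
  have "p_integral p (of_int 0 - (\<Sum>i\<in>F. x i))"
    using insert by (intro p_integral_diff[OF p p_integral_of_int[OF p]]) auto
  then have "p_integral p (x i - (of_int 0 - (\<Sum>i\<in>F. x i)))"
    by (rule p_integral_diff[OF p insert.prems[OF insertI1]])
  then show ?case
    using insert by simp
qed (use p_integral_of_int[OF p, of 0] in simp_all)

lemma p_integral_cancel:
  assumes p: "prime p" and m: "\<not> int p dvd m" and x: "p_integral p (of_int m * x)"
  shows "p_integral p x"
proof -
  obtain k :: int where "\<not> int p dvd k" "of_int k * (of_int m * x) \<in> \<int>"
    using x by (auto simp: p_integral_def)
  then show ?thesis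
    using p m unfolding p_integral_def
    by (intro exI[of _ "k * m"]) (simp add: prime_dvd_mult_iff mult.assoc)
qed

text \<open>A prime dividing the reduced denominator \<open>d\<close> would also divide the
  numerator, since it does not divide the multiplier \<open>m\<close>. So \<open>d\<close> is
  1.\<close>

lemma Ints_if_p_integral:
  assumes "\<And>p. prime p \<Longrightarrow> p_integral p x"
  shows "x \<in> \<int>"
proof -
  obtain a d where x: "x = of_int a / of_int d" "d > 0" "coprime a d"
    by (cases x) (auto simp: Fract_of_int_quotient)
  have "\<not> p dvd nat d" if p: "prime p" for p
  proof
    assume pd: "p dvd nat d"
    obtain m :: int where m: "\<not> int p dvd m" "of_int m * x \<in> \<int>"
      using assms[OF p] by (auto simp: p_integral_def)
    then obtain k where "of_int m * x = of_int k"
      by (elim Ints_cases)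
    then have "(of_int (m * a) :: rat) = of_int (k * d)"
      using x by (simp add: field_simps)
    then have "m * a = k * d"
      by (simp only: of_int_eq_iff)
    moreover have pd': "int p dvd d"
      using pd x(2) int_dvd_int_iff[of p "nat d"] by simp
    ultimately have "int p dvd a"
      using m p by (metis dvd_mult prime_dvd_mult_iff prime_nat_int_transfer)
    then show False
      using pd' x(3) p by (metis not_coprimeI not_prime_unit prime_nat_int_transfer)
  qed
  then have "nat d = 1"
    using prime_factor_nat by blast
  then have "d = 1"
    by simp
  then show ?thesis
    using x by simp
qed

section \<open>Open subgroups of \<open>U\<close> and the matrix \<open>zeta_q\<close>\<close>

locale open_subgroup_of_profinite = profinite_group G T for G (structure) and T +
  fixes U
  assumes open_U: "open_subgroup G T U"
begin

abbreviation GU where "GU \<equiv> G\<lparr>carrier := U\<rparr>"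

abbreviation OU where "OU \<equiv> open_classes GU (subtopology T U)"

lemma subgroup_U: "subgroup U G"
  using open_U by (simp add: open_subgroup_def)

sublocale GU: group GU
  by (rule subgroup.subgroup_is_group[OF subgroup_U is_group])

lemma open_GU: "open_subgroup GU (subtopology T U) A \<longleftrightarrow> A \<subseteq> U \<and> open_subgroup G T A"
proof -
  have "openin T U"
    using open_U by (simp add: open_subgroup_def)
  then show ?thesis
    using incl_subgroup[OF subgroup_U] subgroup_incl[OF _ subgroup_U]
      subgroup.subset[of A GU]
    unfolding open_subgroup_def by (auto simp: openin_open_subtopology)
qed

lemma open_GU_conjugate:
  assumes A: "open_subgroup GU (subtopology T U) A" and u: "u \<in> U"
  shows "open_subgroup GU (subtopology T U) (u <#\<^bsub>GU\<^esub> A #>\<^bsub>GU\<^esub> inv\<^bsub>GU\<^esub> u)"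
proof -
  have eq: "u <#\<^bsub>GU\<^esub> A #>\<^bsub>GU\<^esub> inv\<^bsub>GU\<^esub> u = u <# A #> inv u"
    using subgroup_U u by simp
  have "subgroup (u <#\<^bsub>GU\<^esub> A #>\<^bsub>GU\<^esub> inv\<^bsub>GU\<^esub> u) GU"
    using A u by (intro GU.subgroup_conjugation_is_surj2) (auto simp: open_subgroup_def)
  then have "u <# A #> inv u \<subseteq> U"
    using subgroup.subset eq by fastforce
  moreover have "u \<in> carrier G"
    using u subgroup.subset[OF subgroup_U] by blast
  ultimately show ?thesis
    using A open_subgroup_conjugate unfolding open_GU eq by blast
qed

lemma subgroup_if_open: "open_subgroup GU (subtopology T U) A \<Longrightarrow> subgroup A GU"
  by (simp add: open_subgroup_def)

lemma subgroup_if_open_G: "open_subgroup G T A \<Longrightarrow> subgroup A G"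
  by (simp add: open_subgroup_def)

lemma index_GU:
  assumes "open_subgroup GU (subtopology T U) A"
  shows "subgroup_index GU A > 0"
proof -
  have A: "A \<subseteq> U" "open_subgroup G T A"
    using assms by (simp_all add: open_GU)
  then have "subgroup_index G A = subgroup_index G U * subgroup_index GU A"
    using subgroup_U by (intro subgroup_index_mult) (auto simp: open_subgroup_def)
  then show ?thesis
    using open_subgroup_index_pos[OF A(2)] by (auto intro: gr0I)
qed

lemma rep_class:
  assumes A: "open_subgroup GU (subtopology T U) A"
  obtains u where "u \<in> U" "rep (conj_class GU A) = u <#\<^bsub>GU\<^esub> A #>\<^bsub>GU\<^esub> inv\<^bsub>GU\<^esub> u"
  using GU.rep_conj_class[OF subgroup.subset[OF subgroup_if_open[OF A]]]
  by (metis partial_object.select_convs(1) partial_object.surjective partial_object.update_convs(1))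

lemma open_rep:
  assumes "s \<in> OU"
  shows "open_subgroup GU (subtopology T U) (rep s)"
proof -
  obtain A where A: "open_subgroup GU (subtopology T U) A" "s = conj_class GU A"
    using assms by (auto simp: open_classes_def)
  obtain u where u: "u \<in> U" "rep s = u <#\<^bsub>GU\<^esub> A #>\<^bsub>GU\<^esub> inv\<^bsub>GU\<^esub> u"
    using rep_class[OF A(1)] unfolding A(2) .
  show ?thesis
    unfolding u(2) using A(1) u(1) by (rule open_GU_conjugate)
qed

lemma conj_class_rep:
  assumes "s \<in> OU"
  shows "conj_class GU (rep s) = s"
proof -
  obtain A where A: "open_subgroup GU (subtopology T U) A" "s = conj_class GU A"
    using assms by (auto simp: open_classes_def)
  obtain u where "u \<in> U" "rep s = u <#\<^bsub>GU\<^esub> A #>\<^bsub>GU\<^esub> inv\<^bsub>GU\<^esub> u"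
    using rep_class[OF A(1)] A(2) by blast
  then show ?thesis
    using GU.conj_class_conjugate[OF _ subgroup.subset[OF subgroup_if_open[OF A(1)]], of u] A(2)
    by simp
qed

lemma class_in_O: "open_subgroup GU (subtopology T U) A \<Longrightarrow> conj_class GU A \<in> OU"
  by (auto simp: open_classes_def)

lemma subgroup_rep: "s \<in> OU \<Longrightarrow> subgroup (rep s) GU"
  using open_rep subgroup_if_open by blast

lemma rep_subset: "s \<in> OU \<Longrightarrow> rep s \<subseteq> U"
  using subgroup.subset[OF subgroup_rep] by simp

lemma index_rep: "s \<in> OU \<Longrightarrow> subgroup_index GU (rep s) > 0"
  using index_GU[OF open_rep] .

text \<open>This gives the triangular shape of the matrix: among comparable classes, equal finite
  index forces conjugacy.\<close>

lemma conj_le_index: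
  assumes s: "s \<in> OU" and v: "v \<in> OU" and le: "conj_le GU (rep s) (rep v)"
  shows "s = v \<or> subgroup_index GU (rep s) < subgroup_index GU (rep v)"
proof (cases "subgroup_index GU (rep v) = subgroup_index GU (rep s)")
  case True
  obtain u where "u \<in> carrier GU" "rep v = u <#\<^bsub>GU\<^esub> rep s #>\<^bsub>GU\<^esub> inv\<^bsub>GU\<^esub> u"
    using GU.index_of_conj_le(2)[OF subgroup_rep[OF s] subgroup_rep[OF v] le True index_rep[OF s]]
    by blast
  then have "conj_class GU (rep v) = conj_class GU (rep s)"
    using GU.conj_class_conjugate[of u "rep s"] rep_subset[OF s] by simp
  then show ?thesis
    using conj_class_rep s v by simp
next
  case False
  have "subgroup_index GU (rep s) dvd subgroup_index GU (rep v)"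
    using GU.index_of_conj_le(1)[OF subgroup_rep[OF s] subgroup_rep[OF v] le] .
  then have "subgroup_index GU (rep s) \<le> subgroup_index GU (rep v)"
    using index_rep[OF v] by (rule dvd_imp_le)
  with False show ?thesis by simp
qed

text \<open>A suitable conjugate of \<open>rep s\<close> contains \<open>V\<close> and is a union of
  cosets of \<open>V\<close>, of which there are finitely many.\<close>

lemma finite_conj_le:
  assumes V: "open_subgroup GU (subtopology T U) V"
  shows "finite {s \<in> OU. conj_le GU (rep s) V}"
proof (rule finite_subset)
  show "finite ((\<lambda>F. conj_class GU (\<Union>F)) ` Pow (lcosets\<^bsub>GU\<^esub> V))"
    using index_GU[OF V] by (auto simp: subgroup_index_def intro: card_ge_0_finite)
  show "{s \<in> OU. conj_le GU (rep s) V} \<subseteq> (\<lambda>F. conj_class GU (\<Union>F)) ` Pow (lcosets\<^bsub>GU\<^esub> V)"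
  proof clarify
    fix s assume s: "s \<in> OU" and "conj_le GU (rep s) V"
    then obtain u where u: "u \<in> U" "V \<subseteq> u <#\<^bsub>GU\<^esub> rep s #>\<^bsub>GU\<^esub> inv\<^bsub>GU\<^esub> u"
      by (auto simp: conj_le_def simp del: l_coset_consistent r_coset_consistent)
    define S where "S = u <#\<^bsub>GU\<^esub> rep s #>\<^bsub>GU\<^esub> inv\<^bsub>GU\<^esub> u"
    have S: "subgroup S GU"
      unfolding S_def using u subgroup_rep[OF s] by (intro GU.subgroup_conjugation_is_surj2) simp_all
    have union: "S = \<Union>((\<lambda>x. x <#\<^bsub>GU\<^esub> V) ` S)"
    proof (intro subset_antisym subsetI)
      fix x assume "x \<in> S"
      then show "x \<in> \<Union>((\<lambda>x. x <#\<^bsub>GU\<^esub> V) ` S)"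
        using GU.lcos_self[OF _ subgroup_if_open[OF V], of x] subgroup.subset[OF S] by blast
    next
      fix x assume "x \<in> \<Union>((\<lambda>x. x <#\<^bsub>GU\<^esub> V) ` S)"
      then obtain y v where "y \<in> S" "v \<in> V" "x = y \<otimes>\<^bsub>GU\<^esub> v"
        unfolding l_coset_def by blast
      then show "x \<in> S"
        using u(2) subgroup.m_closed[OF S] unfolding S_def by blast
    qed
    have sub: "(\<lambda>x. x <#\<^bsub>GU\<^esub> V) ` S \<in> Pow (lcosets\<^bsub>GU\<^esub> V)"
      using lcosetsI[of _ GU] subgroup.subset[OF S] by blast
    have "s = conj_class GU S"
      unfolding S_def using GU.conj_class_conjugate[of u "rep s"] u rep_subset[OF s] conj_class_rep[OF s]
      by simp
    then have "s = conj_class GU (\<Union>((\<lambda>x. x <#\<^bsub>GU\<^esub> V) ` S))"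
      by (simp only: union[symmetric])
    with sub show "s \<in> (\<lambda>F. conj_class GU (\<Union>F)) ` Pow (lcosets\<^bsub>GU\<^esub> V)"
      by (rule rev_image_eqI)
  qed
qed

text \<open>Where the order relation fails there is no fixed point, and the monomial vanishes by
  itself.\<close>

lemma zeta_eq:
  assumes "v \<in> OU" "s \<in> OU"
  shows "zeta_q GU v s = Polynomial.monom (of_nat (phi GU (rep v) (rep s))) (rel_index GU (rep s) (rep v) - 1)"
proof (cases "conj_le GU (rep s) (rep v)")
  case False
  then have "phi GU (rep v) (rep s) = 0"
    using GU.conj_le_of_phi[OF subgroup_rep[OF assms(2)]] rep_subset[OF assms(1)] by auto
  then show ?thesis
    using False by (simp add: zeta_q_def)
qed (simp add: zeta_q_def)

lemma zeta_nonzero: "zeta_q GU v s \<noteq> 0 \<Longrightarrow> conj_le GU (rep s) (rep v)"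
  by (auto simp: zeta_q_def split: if_splits)

lemma section_acting_GU:
  assumes V: "open_subgroup GU (subtopology T U) V" and S: "open_subgroup GU (subtopology T U) S"
  shows "section_acting GU (normalizing GU V) V S"
  using GU.subgroup_normalizing[OF subgroup_if_open[OF V]] assms index_GU subgroup_if_open
  by (intro section_acting.intro section_acting_axioms.intro GU.is_group) auto

text \<open>The normalizer is taken in \<open>U\<close> here as well, so that one and the same group
  acts on the fixed cosets of both sides of the system.\<close>

lemma section_acting_G:
  assumes V: "open_subgroup GU (subtopology T U) V" and W: "open_subgroup G T W"
  shows "section_acting G (normalizing GU V) V W"
proof -
  have "subgroup (normalizing GU V) G"
    using incl_subgroup[OF subgroup_U] GU.subgroup_normalizing(1)[OF subgroup_if_open[OF V]] .
  moreover have "V \<lhd> (G\<lparr>carrier := normalizing GU V\<rparr>)"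
    using GU.subgroup_normalizing(2)[OF subgroup_if_open[OF V]] by simp
  ultimately show ?thesis
    using open_subgroup_index_pos[of V] open_subgroup_index_pos[of W] V W
    by (intro section_acting.intro section_acting_axioms.intro is_group)
      (auto simp: open_GU intro: subgroup_if_open_G)
qed

lemma phi_rep_self:
  assumes "v \<in> OU"
  shows "phi GU (rep v) (rep v) = card (carrier ((G\<lparr>carrier := normalizing GU (rep v)\<rparr>) Mod rep v))"
    and "phi GU (rep v) (rep v) > 0"
proof -
  interpret R: section_acting GU "normalizing GU (rep v)" "rep v" "rep v"
    using assms open_rep by (intro section_acting_GU)
  show *: "phi GU (rep v) (rep v) = card (carrier ((G\<lparr>carrier := normalizing GU (rep v)\<rparr>) Mod rep v))"
    using GU.phi_self[OF subgroup_rep[OF assms] index_rep[OF assms]] by simp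
  show "phi GU (rep v) (rep v) > 0"
    using R.finite_K R.K.carrier_not_empty unfolding * by (simp add: card_gt_0_iff)
qed

sublocale Z: triangular_matrix OU "zeta_q GU" "\<lambda>v. subgroup_index GU (rep v)"
proof
  show "row_finite OU (zeta_q GU)"
    unfolding row_finite_def
  proof
    fix v assume v: "v \<in> OU"
    show "finite {s \<in> OU. zeta_q GU v s \<noteq> 0}"
      by (rule finite_subset[OF _ finite_conj_le[OF open_rep[OF v]]]) (use zeta_nonzero in blast)
  qed
  show "zeta_q GU v v dvd 1" if v: "v \<in> OU" for v
  proof -
    \<comment> \<open>The diagonal exponent is 0, so the entry is a nonzero rational constant and
      thus a unit among the polynomials.\<close>
    have "rel_index GU (rep v) (rep v) - 1 = 0"
      using index_rep[OF v] by (simp add: rel_index_def)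
    then have "zeta_q GU v v = [:of_nat (phi GU (rep v) (rep v)):]"
      unfolding zeta_eq[OF v v] by (simp add: monom_0)
    then show ?thesis
      using phi_rep_self(2)[OF v] by (simp add: is_unit_const_poly_iff dvd_field_iff)
  qed
  show "s = v \<or> subgroup_index GU (rep s) < subgroup_index GU (rep v)"
    if "v \<in> OU" "s \<in> OU" "zeta_q GU v s \<noteq> 0" for v s
    using conj_le_index that zeta_nonzero by blast
qed

lemma mu_support:
  assumes "v \<in> OU" "s \<in> OU" "mu_q GU (subtopology T U) v s \<noteq> 0"
  shows "conj_le GU (rep s) (rep v)"
  using assms unfolding mu_q_def
proof (rule Z.mat_inverse_support[where P = "\<lambda>v s. conj_le GU (rep s) (rep v)", rotated 2])
  show "conj_le GU (rep v) (rep v)" if "v \<in> OU" for v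
    using GU.conj_le_refl[of "rep v"] rep_subset[OF that] by simp
  show "conj_le GU (rep j) (rep i)"
    if "i \<in> OU" "k \<in> OU" "j \<in> OU" "zeta_q GU i k \<noteq> 0" "conj_le GU (rep j) (rep k)" for i j k
    using GU.conj_le_trans[OF that(5) zeta_nonzero[OF that(4)]] rep_subset[OF that(3)] by simp
qed

end

section \<open>The linear system and the integrality of its solution\<close>

locale q_restriction = open_subgroup_of_profinite +
  fixes w
  assumes w: "w \<in> open_classes G T"
begin

lemma open_rep_w: "open_subgroup G T (rep w)"
proof -
  obtain W where W: "open_subgroup G T W" "w = conj_class G W"
    using w by (auto simp: open_classes_def)
  obtain g where "g \<in> carrier G" "rep w = g <# W #> inv g"
    using rep_conj_class[of W] W by (metis open_subgroup_def subgroup.subset)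
  then show ?thesis
    using open_subgroup_conjugate W by simp
qed

lemma subgroup_rep_w: "subgroup (rep w) G"
  using open_rep_w by (simp add: open_subgroup_def)

definition rhs :: "'a set set \<Rightarrow> rat poly" where
  "rhs s = Polynomial.monom (of_nat (phi G (rep s) (rep w))) (rel_index G (rep w) (rep s) - 1)"

definition Q :: "'a set set \<Rightarrow> rat poly" where
  "Q v = Q_poly G T U v w"

text \<open>The two order conditions in \<open>Q_poly\<close> discard only zero terms: the one on
  \<open>w\<close> because \<open>phi\<close> vanishes, the one on \<open>v\<close> by
  \<open>mu_support\<close>. So \<open>Q\<close> is the inverse matrix applied to
  \<open>rhs\<close>.\<close>

lemma Q_eq:
  assumes v: "v \<in> OU"
  shows "Q v = (\<Sum>s | s \<in> OU \<and> mu_q GU (subtopology T U) v s \<noteq> 0. mu_q GU (subtopology T U) v s * rhs s)"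
proof -
  let ?mu = "mu_q GU (subtopology T U) v"
  let ?A = "{s. s \<in> OU \<and> conj_le G (rep w) (rep s) \<and> conj_le GU (rep s) (rep v)}"
  let ?B = "{s. s \<in> OU \<and> ?mu s \<noteq> 0}"
  let ?C = "{s \<in> OU. conj_le GU (rep s) (rep v)}"
  have fin: "finite ?C"
    using finite_conj_le[OF open_rep[OF v]] .
  have "rhs s = 0" if "s \<in> OU" "\<not> conj_le G (rep w) (rep s)" for s
  proof -
    have "phi G (rep s) (rep w) = 0"
      using that conj_le_of_phi[OF subgroup_rep_w, of "rep s"] rep_subset[OF that(1)]
        subgroup.subset[OF subgroup_U] by auto
    then show ?thesis
      by (simp add: rhs_def)
  qed
  then have "(\<Sum>s\<in>?A. ?mu s * rhs s) = (\<Sum>s\<in>?C. ?mu s * rhs s)"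
    using fin by (intro sum.mono_neutral_left) auto
  also have "\<dots> = (\<Sum>s\<in>?B. ?mu s * rhs s)"
    using fin mu_support[OF v] by (intro sum.mono_neutral_right) auto
  finally show ?thesis
    by (simp add: Q_def Q_poly_def rhs_def)
qed

lemma zeta_Q:
  assumes v: "v \<in> OU"
  shows "(\<Sum>s | s \<in> OU \<and> zeta_q GU v s \<noteq> 0. zeta_q GU v s * Q s) = rhs v"
  using Z.mat_inverse_solves[OF v, of rhs] by (simp add: Q_eq mu_q_def)

text \<open>The system defining \<open>Q\<close> holds for all open subgroups \<open>A\<close> of \<open>U\<close>, not only for the chosen
  representatives of their classes.\<close>

lemma Q_system:
  fixes n :: int
  assumes A: "open_subgroup GU (subtopology T U) A"
    and F: "finite F" "F \<subseteq> OU" "\<And>s. s \<in> OU \<Longrightarrow> phi GU A (rep s) \<noteq> 0 \<Longrightarrow> s \<in> F"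
  shows "(\<Sum>s\<in>F. of_int (int (phi GU A (rep s)) * n ^ (rel_index GU (rep s) A - 1)) * poly (Q s) (of_int n))
    = of_int (int (phi G A (rep w)) * n ^ (rel_index G (rep w) A - 1))"
proof -
  define a where "a = conj_class GU A"
  have a: "a \<in> OU"
    unfolding a_def by (rule class_in_O[OF A])
  obtain u where u: "u \<in> U" "rep a = u <#\<^bsub>GU\<^esub> A #>\<^bsub>GU\<^esub> inv\<^bsub>GU\<^esub> u"
    using rep_class[OF A] unfolding a_def by blast
  have uG: "u \<in> carrier G"
    using u(1) subgroup.subset[OF subgroup_U] by blast
  have rep_a: "rep a = u <# A #> inv u"
    using u subgroup_U by simp
  have A_sub: "subgroup A G" "subgroup A GU"
    using A subgroup_if_open by (auto simp: open_GU intro: subgroup_if_open_G)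
  \<comment> \<open>The representative of the class of \<open>A\<close> is a conjugate of
    \<open>A\<close>; fixed-point numbers and indices agree for both.\<close>
  have phi_GU: "phi GU (rep a) (rep s) = phi GU A (rep s)" if "s \<in> OU" for s
    unfolding u(2) using u(1) subgroup.subset[OF A_sub(2)] subgroup_rep[OF that]
    by (intro GU.phi_conjugate) simp_all
  have phi_G: "phi G (rep a) (rep w) = phi G A (rep w)"
    unfolding rep_a using uG subgroup.subset[OF A_sub(1)] subgroup_rep_w by (rule phi_conjugate)
  have "subgroup_index GU (rep a) = subgroup_index GU A"
    unfolding u(2) using u(1) A_sub(2) by (intro GU.subgroup_index_conjugate) simp_all
  moreover have "subgroup_index G (rep a) = subgroup_index G A"
    unfolding rep_a using uG A_sub(1) by (rule subgroup_index_conjugate)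
  ultimately have index: "subgroup_index GU (rep a) = subgroup_index GU A"
    "subgroup_index G (rep a) = subgroup_index G A" .
  have zeta: "zeta_q GU a s = Polynomial.monom (of_nat (phi GU A (rep s))) (rel_index GU (rep s) A - 1)"
    if "s \<in> OU" for s
    unfolding zeta_eq[OF a that] phi_GU[OF that] by (simp add: rel_index_def index)
  \<comment> \<open>Any finite \<open>F\<close> containing the support may serve as index set, so
    equations for different \<open>A\<close> can later be added over one \<open>F\<close>.\<close>
  have "(\<Sum>s | s \<in> OU \<and> zeta_q GU a s \<noteq> 0. zeta_q GU a s * Q s) = (\<Sum>s\<in>F. zeta_q GU a s * Q s)"
    using F by (intro row_sum_eq) (auto simp: zeta)
  then have "(\<Sum>s\<in>F. zeta_q GU a s * Q s) = rhs a"
    using zeta_Q[OF a] by simp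
  then have "(\<Sum>s\<in>F. poly (zeta_q GU a s) (of_int n) * poly (Q s) (of_int n)) = poly (rhs a) (of_int n)"
    by (simp flip: poly_sum poly_mult)
  moreover have "poly (zeta_q GU a s) (of_int n) =
      of_int (int (phi GU A (rep s)) * n ^ (rel_index GU (rep s) A - 1))" if "s \<in> F" for s
    using that F(2) by (auto simp: zeta poly_monom subset_iff)
  moreover have "poly (rhs a) (of_int n) =
      of_int (int (phi G A (rep w)) * n ^ (rel_index G (rep w) A - 1))"
    by (simp add: rhs_def phi_G rel_index_def index poly_monom)
  ultimately show ?thesis
    by simp
qed

lemma p_integral_Q:
  fixes n :: int
  assumes p: "prime p" and "v \<in> OU"
  shows "p_integral p (poly (Q v) (of_int n))"
  using assms(2)
proof (induction "subgroup_index GU (rep v)" arbitrary: v rule: less_induct)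
  case less
  note v = less.prems
  let ?V = "rep v"
  let ?H = "normalizing GU ?V"
  let ?K = "(G\<lparr>carrier := ?H\<rparr>) Mod ?V"
  let ?N = "card (carrier ?K)"
  let ?y = "\<lambda>s. poly (Q s) (of_int n) :: rat"
  define F where "F = {s \<in> OU. conj_le GU (rep s) ?V}"
  have F: "finite F" "F \<subseteq> OU"
    using finite_conj_le[OF open_rep[OF v]] by (auto simp: F_def)
  have vF: "v \<in> F"
    using v GU.conj_le_refl[of ?V] rep_subset[OF v] by (simp add: F_def)
  have N: "?N > 0" "phi GU ?V ?V = ?N"
    using phi_rep_self[OF v] by auto
  have IH: "p_integral p (?y s)" if "s \<in> F - {v}" for s
    using that conj_le_index[of s v] v by (intro less.hyps) (auto simp: F_def)
  \<comment> \<open>Common end of both cases: divide the integral equation by \<open>?N\<close>,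
    move the terms of smaller index to the right, where the induction hypothesis applies, and cancel
    \<open>m\<close>, which is prime to \<open>p\<close>.\<close>
  have conclude: "p_integral p (?y v)"
    if m: "\<not> int p dvd m" and c: "c v = int ?N * m" "\<And>s. s \<in> F \<Longrightarrow> int ?N dvd c s" "int ?N dvd d"
      and eq: "(\<Sum>s\<in>F. of_int (c s) * ?y s) = of_int d" for m c d
  proof -
    define c' where "c' = (\<lambda>s. c s div int ?N)"
    have c': "c s = int ?N * c' s" if "s \<in> F" for s
      using c(2)[OF that] by (simp add: c'_def)
    obtain d' where d': "d = int ?N * d'"
      using c(3) by (elim dvdE)
    have "of_int (int ?N) * (\<Sum>s\<in>F. of_int (c' s) * ?y s) = (\<Sum>s\<in>F. of_int (c s) * ?y s)"
      unfolding sum_distrib_left by (intro sum.cong refl) (simp add: c')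
    also have "\<dots> = of_int (int ?N) * of_int d'"
      unfolding eq d' by simp
    finally have "(\<Sum>s\<in>F. of_int (c' s) * ?y s) = of_int d'"
      using N(1) by simp
    moreover have "c' v = m"
      using c(1) N(1) by (simp add: c'_def)
    ultimately have "of_int m * ?y v = of_int d' - (\<Sum>s\<in>F - {v}. of_int (c' s) * ?y s)"
      using sum.remove[OF F(1) vF, of "\<lambda>s. of_int (c' s) * ?y s"] by simp
    also have "p_integral p \<dots>"
      by (intro p_integral_diff p_integral_of_int p_integral_sum p_integral_mult_int IH p)
    finally show ?thesis
      by (rule p_integral_cancel[OF p m])
  qed
  have KU: "(GU\<lparr>carrier := ?H\<rparr>) Mod ?V = ?K"
    by simp
  interpret RG: section_acting G ?H ?V "rep w"
    by (rule section_acting_G[OF open_rep[OF v] open_rep_w])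
  have RU: "section_acting GU ?H ?V (rep s)" if "s \<in> OU" for s
    by (rule section_acting_GU[OF open_rep[OF v] open_rep[OF that]])
  show ?case
  proof (cases "int p dvd n")
    case True
    obtain a b where ab: "?N = p ^ a * b" "\<not> p dvd b"
      using N(1) p by (metis multiplicity_decompose' neq0_conv not_prime_unit)
    let ?c = "\<lambda>s. int (phi GU ?V (rep s)) * n ^ (rel_index GU (rep s) ?V - 1)"
    let ?d = "int (phi G ?V (rep w)) * n ^ (rel_index G (rep w) ?V - 1)"
    have "(\<Sum>s\<in>F. of_int (?c s) * ?y s) = of_int ?d"
    proof (rule Q_system[OF open_rep[OF v] F])
      show "s \<in> F" if "s \<in> OU" "phi GU ?V (rep s) \<noteq> 0" for s
        using that GU.conj_le_of_phi[OF subgroup_rep[OF that(1)]] rep_subset[OF v] by (simp add: F_def)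
    qed
    \<comment> \<open>The equation for \<open>V\<close> gives divisibility by the
      \<open>p\<close>-part of \<open>?N\<close> only; the factor \<open>b\<close> supplies the
      rest. Here \<open>m\<close> is \<open>b\<close>.\<close>
    then have "of_int (int b) * (\<Sum>s\<in>F. of_int (?c s) * ?y s) = of_int (int b) * of_int ?d"
      by simp
    then have "(\<Sum>s\<in>F. of_int (int b * ?c s) * ?y s) = of_int (int b * ?d)"
      by (simp only: sum_distrib_left of_int_mult mult.assoc)
    then show ?thesis
    proof (rule conclude[rotated 4])
      show "\<not> int p dvd int b"
        using ab by simp
      \<comment> \<open>At \<open>v\<close> the exponent is 0, so no power of \<open>n\<close>
        enters the coefficient.\<close>
      have "rel_index GU ?V ?V = 1"
        using index_rep[OF v] by (simp add: rel_index_def)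
      then show "int b * ?c v = int ?N * int b"
        by (simp add: N(2))
      show "int ?N dvd int b * ?c s" if "s \<in> F" for s
        using section_acting.card_dvd_phi_power[OF RU p True] that F(2) ab unfolding KU by blast
      show "int ?N dvd int b * ?d"
        using RG.card_dvd_phi_power[OF p True ab] .
    qed
  next
    case False
    let ?cyc = "section_acting.cyc G ?H ?V"
    \<comment> \<open>The actions on cosets in \<open>U\<close> and in \<open>G\<close> involve the
      same quotient group, and \<open>cyc\<close> does not depend on the cosets acted upon.\<close>
    have cyc_GU: "section_acting.cyc GU ?H ?V \<kappa> = ?cyc \<kappa>" for \<kappa>
      using RU[OF v] RG.section_acting_axioms by (simp add: section_acting.cyc_def)
    let ?c = "\<lambda>s. \<Sum>\<kappa>\<in>carrier ?K. int (phi GU (?cyc \<kappa>) (rep s)) * n ^ rel_index GU (rep s) (?cyc \<kappa>)"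
    let ?d = "\<Sum>\<kappa>\<in>carrier ?K. int (phi G (?cyc \<kappa>) (rep w)) * n ^ rel_index G (rep w) (?cyc \<kappa>)"
    have cyc: "open_subgroup GU (subtopology T U) (?cyc \<kappa>)" "?V \<subseteq> ?cyc \<kappa>" if "\<kappa> \<in> carrier ?K" for \<kappa>
    proof -
      show "?V \<subseteq> ?cyc \<kappa>"
        using RG.cyc(2)[OF that] .
      moreover have "?cyc \<kappa> \<subseteq> U"
        using RG.cyc(3)[OF that] by (auto simp: normalizing_def)
      ultimately show "open_subgroup GU (subtopology T U) (?cyc \<kappa>)"
        using open_subgroup_supergroup[OF _ RG.cyc(1)[OF that], of ?V] open_rep[OF v]
        by (simp add: open_GU)
    qed
    have conj_le_cyc: "conj_le GU (rep s) (?cyc \<kappa>)"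
      if "\<kappa> \<in> carrier ?K" "s \<in> OU" "phi GU (?cyc \<kappa>) (rep s) \<noteq> 0" for \<kappa> s
      using that GU.conj_le_of_phi[OF subgroup_rep[OF that(2)]]
        subgroup.subset[OF subgroup_if_open[OF cyc(1)[OF that(1)]]] by blast
    have sys: "(\<Sum>s\<in>F. of_int (int (phi GU (?cyc \<kappa>) (rep s)) * n ^ rel_index GU (rep s) (?cyc \<kappa>)) * ?y s)
        = of_int (int (phi G (?cyc \<kappa>) (rep w)) * n ^ rel_index G (rep w) (?cyc \<kappa>))"
      if \<kappa>: "\<kappa> \<in> carrier ?K" for \<kappa>
    proof -
      have sub: "subgroup (?cyc \<kappa>) GU" "subgroup_index GU (?cyc \<kappa>) > 0"
        "subgroup (?cyc \<kappa>) G" "subgroup_index G (?cyc \<kappa>) > 0"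
        using cyc(1)[OF \<kappa>] subgroup_if_open index_GU open_subgroup_index_pos subgroup_if_open_G
        by (auto simp: open_GU)
      have "(\<Sum>s\<in>F. of_int (int (phi GU (?cyc \<kappa>) (rep s)) * n ^ (rel_index GU (rep s) (?cyc \<kappa>) - 1)) * ?y s)
          = of_int (int (phi G (?cyc \<kappa>) (rep w)) * n ^ (rel_index G (rep w) (?cyc \<kappa>) - 1))"
      proof (rule Q_system[OF cyc(1)[OF \<kappa>] F])
        \<comment> \<open>A conjugate of \<open>rep s\<close> containing
          \<open>?cyc \<kappa>\<close> also contains \<open>?V\<close>, so the same \<open>F\<close>
          serves for every \<kappa>.\<close>
        show "s \<in> F" if s: "s \<in> OU" "phi GU (?cyc \<kappa>) (rep s) \<noteq> 0" for s
          using conj_le_cyc[OF \<kappa> s] cyc(2)[OF \<kappa>] s(1) unfolding F_def conj_le_def by blast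
      qed
      \<comment> \<open>Multiplying by \<open>n\<close> removes the 1 subtracted from the exponents,
        as the Burnside sum requires.\<close>
      then have "(\<Sum>s\<in>F. of_int (int (phi GU (?cyc \<kappa>) (rep s)) * n ^ (rel_index GU (rep s) (?cyc \<kappa>) - 1)) * ?y s) * of_int n
          = of_int (int (phi G (?cyc \<kappa>) (rep w)) * n ^ (rel_index G (rep w) (?cyc \<kappa>) - 1) * n)"
        by simp
      also have "(\<Sum>s\<in>F. of_int (int (phi GU (?cyc \<kappa>) (rep s)) * n ^ (rel_index GU (rep s) (?cyc \<kappa>) - 1)) * ?y s) * of_int n
          = (\<Sum>s\<in>F. of_int (int (phi GU (?cyc \<kappa>) (rep s)) * n ^ (rel_index GU (rep s) (?cyc \<kappa>) - 1) * n) * ?y s)"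
        unfolding sum_distrib_right by (intro sum.cong refl) (simp add: ac_simps)
      also have "\<dots> = (\<Sum>s\<in>F. of_int (int (phi GU (?cyc \<kappa>) (rep s)) * n ^ rel_index GU (rep s) (?cyc \<kappa>)) * ?y s)"
        using GU.phi_power[OF subgroup_rep sub(1,2), of _ n] F(2)
        by (intro sum.cong refl) (simp only: subset_iff)
      also have "int (phi G (?cyc \<kappa>) (rep w)) * n ^ (rel_index G (rep w) (?cyc \<kappa>) - 1) * n
          = int (phi G (?cyc \<kappa>) (rep w)) * n ^ rel_index G (rep w) (?cyc \<kappa>)"
        using phi_power[OF subgroup_rep_w sub(3,4)] .
      finally show ?thesis .
    qed
    have "(\<Sum>s\<in>F. of_int (?c s) * ?y s)
        = (\<Sum>\<kappa>\<in>carrier ?K. \<Sum>s\<in>F. of_int (int (phi GU (?cyc \<kappa>) (rep s)) * n ^ rel_index GU (rep s) (?cyc \<kappa>)) * ?y s)"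
      unfolding of_int_sum sum_distrib_right by (rule sum.swap)
    also have "\<dots> = of_int ?d"
      unfolding of_int_sum using sys by (rule sum.cong[OF refl])
    finally show ?thesis
    proof (rule conclude[rotated 4])
      show "\<not> int p dvd n" by fact
      \<comment> \<open>For \<kappa> other than the identity, \<open>?cyc \<kappa>\<close> has
        smaller index than \<open>?V\<close> and thus lies in no conjugate of it.\<close>
      have "phi GU (?cyc \<kappa>) ?V = 0" if \<kappa>: "\<kappa> \<in> carrier ?K - {?V}" for \<kappa>
      proof (rule ccontr)
        assume "phi GU (?cyc \<kappa>) ?V \<noteq> 0"
        then have "conj_le GU ?V (?cyc \<kappa>)"
          using conj_le_cyc[of \<kappa> v] \<kappa> v by simp
        then have "subgroup_index GU ?V \<le> subgroup_index GU (?cyc \<kappa>)"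
          using GU.index_of_conj_le(1) \<kappa> cyc(1) subgroup_if_open subgroup_rep[OF v] index_GU
          by (intro dvd_imp_le) auto
        moreover have "subgroup_index GU (?cyc \<kappa>) < subgroup_index GU ?V"
          using section_acting.V_less_cyc[OF RU[OF v], of \<kappa>] \<kappa> unfolding KU cyc_GU by simp
        ultimately show False by simp
      qed
      \<comment> \<open>Only the identity of the quotient, which is \<open>?V\<close> as a set,
        remains. Its exponent is 1, so \<open>m\<close> is \<open>n\<close>.\<close>
      then have "?c v = (\<Sum>\<kappa>\<in>{?V}. int (phi GU (?cyc \<kappa>) ?V) * n ^ rel_index GU ?V (?cyc \<kappa>))"
        using RG.finite_K RG.K.one_closed by (intro sum.mono_neutral_right) auto
      also have "\<dots> = int ?N * n"
        using RG.cyc_one index_rep[OF v] by (simp add: N(2) rel_index_def)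
      finally show "?c v = int ?N * n" .
      show "int ?N dvd ?c s" if "s \<in> F" for s
        using section_acting.card_dvd_sum_phi_power[OF RU] that F(2) unfolding KU cyc_GU by blast
      show "int ?N dvd ?d"
        using RG.card_dvd_sum_phi_power .
    qed
  qed
qed

lemma numerical_Q: "v \<in> OU \<Longrightarrow> numerical_poly (Q v)"
  unfolding numerical_poly_def using p_integral_Q Ints_if_p_integral by blast

end

theorem theorem5p11:
  fixes G :: "('a, 'b) monoid_scheme" and T :: "'a topology" and U :: "'a set"
  assumes "profinite_group G T"
    and "open_subgroup G T U"
    and "v \<in> open_classes (G\<lparr>carrier := U\<rparr>) (subtopology T U)"
    and "w \<in> open_classes G T"
  shows "numerical_poly (Q_poly G T U v w)"
proof -
  interpret q_restriction G T U w
    using assms by (intro q_restriction.intro open_subgroup_of_profinite.intro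
        open_subgroup_of_profinite_axioms.intro q_restriction_axioms.intro)
  show ?thesis
    using numerical_Q[OF assms(3)] by (simp add: Q_def)
qed

end
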